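(* Let $\alpha_i$ be a simple root and let $\mu\in P$ be such that $d=\langle\mu,\alpha_i^\vee\rangle\ge0$. Then $$m_{s_i\mu}=m_\mu,\qquad a_{s_i\mu}=-a_\mu,\qquad A_{s_i\mu}=-A_\mu .$$ Moreover, letting $t=q^{-2}$: $M_{s_i\mu}=M_\mu$ if $d=0$, and if $d>0$ then $$M_{s_i\mu}=tM_\mu+\Big(\sum_{j=1}^{\lfloor (d-1)/2\rfloor}(t^2-1)t^{j-1}M_{\mu-j\alpha_i}\Big)+\begin{cases}(t-1)t^{d/2-1}M_{\mu-(d/2)\alpha_i},&\text{if }d\text{ is even},\\ 0,&\text{if }d\text{ is odd}.\end{cases}$$
   Context: Root data. $R$ is a reduced irreducible root system spanning a finite-dimensional real vector space with nondegenerate symmetric bilinear form $\langle\,,\rangle$; $\alpha^\vee=2\alpha/\langle\alpha,\alpha\rangle$; $W$ is the Weyl group, $R^+$ a choice of positive roots, $\alpha_1,\dots,\alpha_n$ the simple roots, $s_i=s_{\alpha_i}$, $\ell$ the length function. $P=\{\lambda:\langle\lambda,\alpha^\vee\rangle\in\mathbb Z\ \forall\alpha\in R\}$, $W_0(t)=\sum_{w\in W}t^{\ell(w)}$. Affine Hecke algebra. $\mathbb K=\mathbb Z[q,q^{-1}]$ with $W_0(q^2)^{-1}$ adjoined. $\tilde H$ is the $\mathbb K$-algebra with generators $T_1,\dots,T_n$ and $x^\lambda$ ($\lambda\in P$) and relations: the braid relations $T_iT_jT_i\cdots=T_jT_iT_j\cdots$ ($m_{ij}$ factors on each side, $m_{ij}$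 the order of $s_is_j$, $i\ne j$); $T_i^2=(q-q^{-1})T_i+1$; $x^\lambda x^\mu=x^\mu x^\lambda=x^{\lambda+\mu}$; and $x^\lambda T_i=T_ix^{s_i\lambda}+(q-q^{-1})\frac{x^\lambda-x^{s_i\lambda}}{1-x^{-\alpha_i}}$. For $w\in W$ with reduced word $w=s_{i_1}\cdots s_{i_p}$, $T_w=T_{i_1}\cdots T_{i_p}$. $W$ acts on $\mathbb K[P]=\mathbb K\text{-span}\{x^\lambda\}$ by $wx^\lambda=x^{w\lambda}$. Put $\mathbf 1_0=\frac1{W_0(q^2)}\sum_{w\in W}q^{\ell(w)}T_w$ and $\varepsilon_0=\frac1{W_0(q^{-2})}\sum_{w\in W}(-q)^{-\ell(w)}T_w$ (idempotents with $T_i\mathbf 1_0=q\mathbf 1_0$, $T_i\varepsilon_0=-q^{-1}\varepsilon_0$). For $\mu\in P$ define $$m_\mu=\sum_{\gamma\in W\mu}x^\gamma,\quad a_\mu=\sum_{w\in W}(-1)^{\ell(w)}x^{w\mu},\quad M_\mu=\mathbf 1_0x^\mu\mathbf 1_0,\quad A_\mu=\varepsilon_0x^\mu\mathbf 1_0 .$$ *)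

theory Defs
  imports
    "HOL-Analysis.Analysis"
    "HOL-Library.Poly_Mapping"
    "HOL-Computational_Algebra.Polynomial_Factorial"
    "HOL-Algebra.QuotRing"
    "HOL-Algebra.Module"
begin

section \<open>Root data\<close>

text \<open>
  The ambient vector space is the whole type \<open>'v\<close>; it is finite-dimensional because the finite set
  of roots spans it.
\<close>

record 'v root_data =
  form :: "'v \<Rightarrow> 'v \<Rightarrow> real"
  roots :: "'v set"
  pos :: "'v set"

definition coroot :: "('v::real_vector) root_data \<Rightarrow> 'v \<Rightarrow> 'v" where
  "coroot D \<alpha> = (2 / form D \<alpha> \<alpha>) *\<^sub>R \<alpha>"

definition pairing :: "('v::real_vector) root_data \<Rightarrow> 'v \<Rightarrow> 'v \<Rightarrow> real" where
  "pairing D \<nu> \<alpha> = form D \<nu> (coroot D \<alpha>)"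

definition reflection :: "('v::real_vector) root_data \<Rightarrow> 'v \<Rightarrow> 'v \<Rightarrow> 'v" where
  "reflection D \<alpha> v = v - pairing D v \<alpha> *\<^sub>R \<alpha>"

text \<open>
  The form is only required to be nondegenerate, not positive definite; roots must be non-isotropic
  for coroots to make sense.  A system of positive roots is one cut out by a linear functional that
  vanishes on no root.
\<close>

locale root_system =
  fixes D :: "('v::real_vector) root_data"
  assumes form_bilinear: "bilinear (form D)"
    and form_sym: "form D u v = form D v u"
    and form_nondegenerate: "(\<And>v. form D u v = 0) \<Longrightarrow> u = 0"
    and finite_roots: "finite (roots D)"
    and span_roots: "span (roots D) = UNIV"
    and nonisotropic: "\<alpha> \<in> roots D \<Longrightarrow> form D \<alpha> \<alpha> \<noteq> 0"
    and refl_roots: "\<alpha> \<in> roots D \<Longrightarrow> \<beta> \<in> roots D \<Longrightarrow> reflection D \<alpha> \<beta> \<in> roots D"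
    and integrality: "\<alpha> \<in> roots D \<Longrightarrow> \<beta> \<in> roots D \<Longrightarrow> pairing D \<beta> \<alpha> \<in> \<int>"
    and reduced: "\<alpha> \<in> roots D \<Longrightarrow> c *\<^sub>R \<alpha> \<in> roots D \<Longrightarrow> c = 1 \<or> c = -1"
    and irreducible: "roots D \<noteq> {}"
      "\<not> (\<exists>R1 R2. R1 \<noteq> {} \<and> R2 \<noteq> {} \<and> R1 \<union> R2 = roots D \<and> R1 \<inter> R2 = {} \<and>
             (\<forall>\<alpha>\<in>R1. \<forall>\<beta>\<in>R2. form D \<alpha> \<beta> = 0))"
    and positive_system:
      "\<exists>f::'v \<Rightarrow> real. linear f \<and> (\<forall>\<alpha>\<in>roots D. f \<alpha> \<noteq> 0) \<and> pos D = {\<alpha> \<in> roots D. 0 < f \<alpha>}"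

definition simple_roots :: "('v::real_vector) root_data \<Rightarrow> 'v set" where
  "simple_roots D = {\<alpha> \<in> pos D. \<not> (\<exists>\<beta>\<in>pos D. \<exists>\<gamma>\<in>pos D. \<alpha> = \<beta> + \<gamma>)}"

definition weight_lattice :: "('v::real_vector) root_data \<Rightarrow> 'v set" where
  "weight_lattice D = {\<nu>. \<forall>\<alpha>\<in>roots D. pairing D \<nu> \<alpha> \<in> \<int>}"

text \<open>Reflections are involutions, so closing under left multiplication by them yields the group they generate.\<close>

inductive_set weyl :: "('v::real_vector) root_data \<Rightarrow> ('v \<Rightarrow> 'v) set"
  for D :: "('v::real_vector) root_data" where
  weyl_id: "id \<in> weyl D"
| weyl_reflection: "\<alpha> \<in> roots D \<Longrightarrow> w \<in> weyl D \<Longrightarrow> reflection D \<alpha> \<circ> w \<in> weyl D"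

text \<open>
  The simple roots index themselves: a word \<open>s\<^bsub>i\<^sub>1\<^esub> \<dots> s\<^bsub>i\<^sub>p\<^esub>\<close> is the list of the simple roots
  \<open>\<alpha>\<^bsub>i\<^sub>1\<^esub>, \<dots>, \<alpha>\<^bsub>i\<^sub>p\<^esub>\<close>.
\<close>

definition word_prod :: "('v::real_vector) root_data \<Rightarrow> 'v list \<Rightarrow> 'v \<Rightarrow> 'v" where
  "word_prod D is = foldr (\<lambda>\<alpha> w. reflection D \<alpha> \<circ> w) is id"

definition len :: "('v::real_vector) root_data \<Rightarrow> ('v \<Rightarrow> 'v) \<Rightarrow> nat" where
  "len D w = (LEAST p. \<exists>is. set is \<subseteq> simple_roots D \<and> word_prod D is = w \<and> length is = p)"

definition reduced_word :: "('v::real_vector) root_data \<Rightarrow> ('v \<Rightarrow> 'v) \<Rightarrow> 'v list \<Rightarrow> bool" where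
  "reduced_word D w is \<longleftrightarrow> set is \<subseteq> simple_roots D \<and> word_prod D is = w \<and> length is = len D w"

definition braid_order :: "('v::real_vector) root_data \<Rightarrow> 'v \<Rightarrow> 'v \<Rightarrow> nat" where
  "braid_order D \<alpha> \<beta> = (LEAST m. 0 < m \<and> (reflection D \<alpha> \<circ> reflection D \<beta>) ^^ m = id)"

definition poincare :: "('v::real_vector) root_data \<Rightarrow> 'k::comm_ring_1 \<Rightarrow> 'k" where
  "poincare D t = (\<Sum>w\<in>weyl D. t ^ len D w)"

section \<open>The coefficient ring\<close>

text \<open>
  \<open>\<int>[q, q\<^sup>-\<^sup>1]\<close> with \<open>W\<^sub>0(q\<^sup>2)\<^sup>-\<^sup>1\<close> adjoined, as a subring of the field of rational functions in \<open>q\<close>.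
\<close>

type_synonym ratfun = "int poly fract"

definition q :: ratfun where
  "q = to_fract (monom 1 1)"

definition coeff_ring :: "('v::real_vector) root_data \<Rightarrow> ratfun set" where
  "coeff_ring D = {to_fract p / (q ^ a * poincare D (q ^ 2) ^ b) | p a b. True}"

section \<open>Free algebras\<close>

datatype 'g word = Word (letters: "'g list")

instantiation word :: (type) monoid_add
begin
definition zero_word :: "'a word" where "0 = Word []"
definition plus_word :: "'a word \<Rightarrow> 'a word \<Rightarrow> 'a word" where
  "u + v = Word (letters u @ letters v)"
instance by standard (simp_all add: zero_word_def plus_word_def)
end

text \<open>
  The free associative unital \<open>K\<close>-algebra on the set \<open>G\<close>: the monoid algebra of the words in \<open>G\<close>
  (a monoid, written additively, under concatenation), with coefficients in the subring \<open>K\<close>.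
\<close>

definition free_algebra :: "'k::comm_ring_1 set \<Rightarrow> 'g set \<Rightarrow> ('g word \<Rightarrow>\<^sub>0 'k) ring" where
  "free_algebra K G =
    \<lparr>carrier = {f. (\<forall>w. Poly_Mapping.lookup f w \<in> K) \<and> (\<forall>w\<in>Poly_Mapping.keys f. set (letters w) \<subseteq> G)},
     mult = (*), one = 1, zero = 0, add = (+)\<rparr>"

definition const :: "'k::comm_ring_1 \<Rightarrow> ('g word \<Rightarrow>\<^sub>0 'k)" where
  "const c = Poly_Mapping.single 0 c"

definition gen :: "'g \<Rightarrow> ('g word \<Rightarrow>\<^sub>0 'k::comm_ring_1)" where
  "gen g = Poly_Mapping.single (Word [g]) 1"

section \<open>The affine Hecke algebra\<close>

datatype 'v hgen = GT 'v | GX 'v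

abbreviation fT :: "'v \<Rightarrow> ('v hgen word \<Rightarrow>\<^sub>0 ratfun)" where
  "fT \<alpha> \<equiv> gen (GT \<alpha>)"

abbreviation fX :: "'v \<Rightarrow> ('v hgen word \<Rightarrow>\<^sub>0 ratfun)" where
  "fX \<nu> \<equiv> gen (GX \<nu>)"

fun alternating :: "'a \<Rightarrow> 'a \<Rightarrow> nat \<Rightarrow> 'a list" where
  "alternating a b 0 = []"
| "alternating a b (Suc m) = a # alternating b a m"

text \<open>
  The group algebra \<open>K[P]\<close>, with \<open>x\<^sup>\<nu>\<close> the basis element \<open>Poly_Mapping.single \<nu> 1\<close>, and its linear
  map to the free algebra sending \<open>x\<^sup>\<nu>\<close> to the generator of that name.
\<close>

definition group_algebra :: "('v::real_vector) root_data \<Rightarrow> ('v \<Rightarrow>\<^sub>0 ratfun) set" where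
  "group_algebra D = {g. Poly_Mapping.keys g \<subseteq> weight_lattice D \<and> (\<forall>\<nu>. Poly_Mapping.lookup g \<nu> \<in> coeff_ring D)}"

definition from_group_algebra :: "('v::real_vector \<Rightarrow>\<^sub>0 ratfun) \<Rightarrow> ('v hgen word \<Rightarrow>\<^sub>0 ratfun)" where
  "from_group_algebra g = (\<Sum>\<nu>\<in>Poly_Mapping.keys g. const (Poly_Mapping.lookup g \<nu>) * fX \<nu>)"

text \<open>A relation \<open>a = b\<close> is recorded as the element \<open>a - b\<close>.\<close>

definition braid_rels :: "('v::real_vector) root_data \<Rightarrow> ('v hgen word \<Rightarrow>\<^sub>0 ratfun) set" where
  "braid_rels D =
    {prod_list (map fT (alternating \<alpha> \<beta> (braid_order D \<alpha> \<beta>)))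
       - prod_list (map fT (alternating \<beta> \<alpha> (braid_order D \<alpha> \<beta>)))
     | \<alpha> \<beta>. \<alpha> \<in> simple_roots D \<and> \<beta> \<in> simple_roots D \<and> \<alpha> \<noteq> \<beta>}"

definition quadratic_rels :: "('v::real_vector) root_data \<Rightarrow> ('v hgen word \<Rightarrow>\<^sub>0 ratfun) set" where
  "quadratic_rels D =
    {fT \<alpha> * fT \<alpha> - (const (q - inverse q) * fT \<alpha> + 1) | \<alpha>. \<alpha> \<in> simple_roots D}"

text \<open>
  The convention \<open>x\<^sup>0 = 1\<close> does not follow from \<open>x\<^sup>\<nu> x\<^sup>\<mu> = x\<^sup>\<nu>\<^sup>+\<^sup>\<mu>\<close> and is imposed explicitly.
\<close>

definition lattice_rels :: "('v::real_vector) root_data \<Rightarrow> ('v hgen word \<Rightarrow>\<^sub>0 ratfun) set" where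
  "lattice_rels D =
    {fX \<nu> * fX \<mu> - fX (\<nu> + \<mu>) | \<nu> \<mu>. \<nu> \<in> weight_lattice D \<and> \<mu> \<in> weight_lattice D} \<union> {fX 0 - 1}"

text \<open>
  \<open>g\<close> is the quotient \<open>(x\<^sup>\<nu> - x\<^bsup>s\<nu>\<^esup>) / (1 - x\<^sup>-\<^sup>\<alpha>)\<close> in \<open>K[P]\<close>, which exists and is unique since
  \<open>1 - x\<^sup>-\<^sup>\<alpha>\<close> is not a zero divisor.
\<close>

definition cross_rels :: "('v::real_vector) root_data \<Rightarrow> ('v hgen word \<Rightarrow>\<^sub>0 ratfun) set" where
  "cross_rels D =
    {fX \<nu> * fT \<alpha> - (fT \<alpha> * fX (reflection D \<alpha> \<nu>) + const (q - inverse q) * from_group_algebra g)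
     | \<nu> \<alpha> g. \<nu> \<in> weight_lattice D \<and> \<alpha> \<in> simple_roots D \<and> g \<in> group_algebra D \<and>
         g * (1 - Poly_Mapping.single (- \<alpha>) 1)
           = Poly_Mapping.single \<nu> 1 - Poly_Mapping.single (reflection D \<alpha> \<nu>) 1}"

definition hecke_free :: "('v::real_vector) root_data \<Rightarrow> ('v hgen word \<Rightarrow>\<^sub>0 ratfun) ring" where
  "hecke_free D = free_algebra (coeff_ring D) (GT ` simple_roots D \<union> GX ` weight_lattice D)"

definition hecke_ideal :: "('v::real_vector) root_data \<Rightarrow> ('v hgen word \<Rightarrow>\<^sub>0 ratfun) set" where
  "hecke_ideal D =
    Idl\<^bsub>hecke_free D\<^esub> (braid_rels D \<union> quadratic_rels D \<union> lattice_rels D \<union> cross_rels D)"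

definition hclass ::
  "('v::real_vector) root_data \<Rightarrow> ('v hgen word \<Rightarrow>\<^sub>0 ratfun) \<Rightarrow> ('v hgen word \<Rightarrow>\<^sub>0 ratfun) set" where
  "hclass D f = hecke_ideal D +>\<^bsub>hecke_free D\<^esub> f"

definition hecke :: "('v::real_vector) root_data \<Rightarrow> (ratfun, ('v hgen word \<Rightarrow>\<^sub>0 ratfun) set) module" where
  "hecke D =
    (let H = hecke_free D Quot hecke_ideal D
     in ring.extend H (module.fields (\<lambda>c h. hclass D (const c) \<otimes>\<^bsub>H\<^esub> h)))"

definition hX :: "('v::real_vector) root_data \<Rightarrow> 'v \<Rightarrow> ('v hgen word \<Rightarrow>\<^sub>0 ratfun) set" where
  "hX D \<nu> = hclass D (fX \<nu>)"

definition hT :: "('v::real_vector) root_data \<Rightarrow> 'v \<Rightarrow> ('v hgen word \<Rightarrow>\<^sub>0 ratfun) set" where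
  "hT D \<alpha> = hclass D (fT \<alpha>)"

definition hTw :: "('v::real_vector) root_data \<Rightarrow> ('v \<Rightarrow> 'v) \<Rightarrow> ('v hgen word \<Rightarrow>\<^sub>0 ratfun) set" where
  "hTw D w =
    foldr (\<lambda>\<alpha> h. hT D \<alpha> \<otimes>\<^bsub>hecke D\<^esub> h) (SOME is. reduced_word D w is) \<one>\<^bsub>hecke D\<^esub>"

definition one0 :: "('v::real_vector) root_data \<Rightarrow> ('v hgen word \<Rightarrow>\<^sub>0 ratfun) set" where
  "one0 D =
    inverse (poincare D (q ^ 2)) \<odot>\<^bsub>hecke D\<^esub>
      (\<Oplus>\<^bsub>hecke D\<^esub>w\<in>weyl D. q ^ len D w \<odot>\<^bsub>hecke D\<^esub> hTw D w)"

definition eps0 :: "('v::real_vector) root_data \<Rightarrow> ('v hgen word \<Rightarrow>\<^sub>0 ratfun) set" where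
  "eps0 D =
    inverse (poincare D (inverse q ^ 2)) \<odot>\<^bsub>hecke D\<^esub>
      (\<Oplus>\<^bsub>hecke D\<^esub>w\<in>weyl D. inverse (- q) ^ len D w \<odot>\<^bsub>hecke D\<^esub> hTw D w)"

definition orbit_sum :: "('v::real_vector) root_data \<Rightarrow> 'v \<Rightarrow> ('v hgen word \<Rightarrow>\<^sub>0 ratfun) set" where
  "orbit_sum D \<mu> = (\<Oplus>\<^bsub>hecke D\<^esub>\<gamma>\<in>(\<lambda>w. w \<mu>) ` weyl D. hX D \<gamma>)"

definition alt_sum :: "('v::real_vector) root_data \<Rightarrow> 'v \<Rightarrow> ('v hgen word \<Rightarrow>\<^sub>0 ratfun) set" where
  "alt_sum D \<mu> = (\<Oplus>\<^bsub>hecke D\<^esub>w\<in>weyl D. (-1) ^ len D w \<odot>\<^bsub>hecke D\<^esub> hX D (w \<mu>))"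

definition M_elt :: "('v::real_vector) root_data \<Rightarrow> 'v \<Rightarrow> ('v hgen word \<Rightarrow>\<^sub>0 ratfun) set" where
  "M_elt D \<mu> = one0 D \<otimes>\<^bsub>hecke D\<^esub> hX D \<mu> \<otimes>\<^bsub>hecke D\<^esub> one0 D"

definition A_elt :: "('v::real_vector) root_data \<Rightarrow> 'v \<Rightarrow> ('v hgen word \<Rightarrow>\<^sub>0 ratfun) set" where
  "A_elt D \<mu> = eps0 D \<otimes>\<^bsub>hecke D\<^esub> hX D \<mu> \<otimes>\<^bsub>hecke D\<^esub> one0 D"

end

theory Submission
  imports Defs
begin

text \<open>
  Multiplying the relation for \<open>x\<^sup>\<mu> T\<^sub>i\<close> by \<open>\<one>\<^sub>0\<close> on the right and by \<open>\<one>\<^sub>0\<close> or \<open>\<epsilon>\<^sub>0\<close> on the left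
  absorbs \<open>T\<^sub>i\<close> and leaves \<open>q M\<^sub>\<mu> = q M\<^bsub>s\<mu>\<^esub> + (q - q\<^sup>-\<^sup>1) (\<Sum>j<d. M\<^bsub>\<mu> - j\<alpha>\<^esub>)\<close> and
  \<open>q A\<^sub>\<mu> = - q\<^sup>-\<^sup>1 A\<^bsub>s\<mu>\<^esub> + (q - q\<^sup>-\<^sup>1) (\<Sum>j<d. A\<^bsub>\<mu> - j\<alpha>\<^esub>)\<close>.  Subtracting the same relation for
  \<open>\<mu> - \<alpha>\<close>, whose pairing is \<open>d - 2\<close>, cancels all but four terms, so both formulas follow by
  induction on \<open>d\<close> in steps of two; the base case \<open>d = 0\<close> for \<open>A\<^sub>\<mu>\<close> uses that \<open>1 + q\<^sup>2\<close> divides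
  \<open>W\<^sub>0(q\<^sup>2)\<close> and hence is a unit.  That \<open>T\<^sub>i\<close> is absorbed by the idempotents rests on Matsumoto's
  theorem, which makes \<open>T\<^sub>w\<close> independent of the reduced word.

  Computations in the Hecke algebra are carried out in the free algebra modulo the ideal of
  relations, where type class algebra is available.
\<close>

section \<open>Root systems and Weyl groups\<close>

text \<open>Write \<open>b j\<close> for the element at \<open>\<mu> - j \<alpha>\<close> and
  \<open>t = q^-2\<close>. Subtracting the relation for \<open>\<mu> - \<alpha>\<close> gives
  \<open>b d = t b 0 - b 1 + t b (d - 1)\<close> for M, after division by q, and
  \<open>b d = - b 0 + q^2 (b 1 + b (d - 1))\<close> for A. The first is the recursion satisfied by
  the closed formula; in the second the bracket vanishes by induction.

  In an algebra given by generators and relations torsion cannot be read off from the presentation,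
  so explicit units are produced. For \<open>d = 0\<close> the relation for A only says
  \<open>(1 + q^2) A = 0\<close>, and every even d descends to this case. The factor
  \<open>1 + q^2\<close> splits off \<open>W_0(q^2)\<close> by grouping W into pairs
  \<open>{w, s w}\<close>. The other unit is \<open>W_0(q^-2)\<close>, by which the sign idempotent
  is divided although only the inverse of \<open>W_0(q^2)\<close> is adjoined. The longest element
  yields \<open>W_0(q^-2) = q^(-2N) W_0(q^2)\<close>, where N is the number of positive roots; the
  counting of inversions serves this identity.\<close>

context root_system
begin

lemma form_simps:
  "form D (u + v) w = form D u w + form D v w"
  "form D (u - v) w = form D u w - form D v w"
  "form D w (u + v) = form D w u + form D w v"
  "form D w (u - v) = form D w u - form D w v"
  "form D (c *\<^sub>R u) w = c * form D u w"
  "form D w (c *\<^sub>R u) = c * form D w u"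
  "form D (- u) w = - form D u w"
  "form D w (- u) = - form D w u"
  using form_bilinear
  by (auto simp: bilinear_ladd bilinear_lsub bilinear_radd bilinear_rsub bilinear_lmul
      bilinear_rmul bilinear_lneg bilinear_rneg)

lemma linear_pairing: "linear (\<lambda>v. pairing D v \<gamma>)"
  by (auto intro!: linearI simp: pairing_def form_simps)

lemma pairing_simps:
  "pairing D (u + v) \<gamma> = pairing D u \<gamma> + pairing D v \<gamma>"
  "pairing D (u - v) \<gamma> = pairing D u \<gamma> - pairing D v \<gamma>"
  "pairing D (c *\<^sub>R u) \<gamma> = c * pairing D u \<gamma>"
  "pairing D (- u) \<gamma> = - pairing D u \<gamma>"
  "pairing D 0 \<gamma> = 0"
  using linear_add[OF linear_pairing, of u v \<gamma>] linear_diff[OF linear_pairing, of u v \<gamma>]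
    linear_scale[OF linear_pairing, of c u \<gamma>] linear_neg[OF linear_pairing, of u \<gamma>]
    linear_0[OF linear_pairing, of \<gamma>]
  by simp_all

lemma pairing_self: "\<alpha> \<in> roots D \<Longrightarrow> pairing D \<alpha> \<alpha> = 2"
  using nonisotropic[of \<alpha>] by (simp add: pairing_def coroot_def form_simps)

lemma linear_reflection: "linear (reflection D \<alpha>)"
  by (auto intro!: linearI simp: reflection_def pairing_simps algebra_simps)

lemma reflection_self: "\<alpha> \<in> roots D \<Longrightarrow> reflection D \<alpha> \<alpha> = - \<alpha>"
  by (simp add: reflection_def pairing_self scaleR_2)

lemma reflection_reflection [simp]:
  "\<alpha> \<in> roots D \<Longrightarrow> reflection D \<alpha> (reflection D \<alpha> v) = v"
  by (simp add: reflection_def pairing_simps pairing_self)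

lemma reflection_comp_self: "\<alpha> \<in> roots D \<Longrightarrow> reflection D \<alpha> \<circ> reflection D \<alpha> = id"
  by (auto simp: fun_eq_iff)

lemma bij_reflection: "\<alpha> \<in> roots D \<Longrightarrow> bij (reflection D \<alpha>)"
  by (rule o_bij[of "reflection D \<alpha>"]) (simp_all add: reflection_comp_self)

lemma uminus_roots: "\<alpha> \<in> roots D \<Longrightarrow> - \<alpha> \<in> roots D"
  using refl_roots[of \<alpha> \<alpha>] by (simp add: reflection_self)

lemma reflection_image_roots: "\<alpha> \<in> roots D \<Longrightarrow> reflection D \<alpha> ` roots D = roots D"
  by (auto simp: refl_roots intro!: image_eqI[of _ _ "reflection D \<alpha> x" for x])

lemma root_nonzero: "\<alpha> \<in> roots D \<Longrightarrow> \<alpha> \<noteq> 0"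
  using pairing_self[of \<alpha>] by (auto simp: pairing_simps)

lemma form_reflection:
  assumes "\<alpha> \<in> roots D"
  shows "form D (reflection D \<alpha> u) (reflection D \<alpha> v) = form D u v"
  using nonisotropic[OF assms] form_sym[of \<alpha> v]
  by (simp add: reflection_def form_simps pairing_def coroot_def field_simps)

lemma pairing_reflection:
  assumes "\<alpha> \<in> roots D"
  shows "pairing D (reflection D \<alpha> u) (reflection D \<alpha> \<gamma>) = pairing D u \<gamma>"
  using form_reflection[OF assms] by (simp add: pairing_def coroot_def form_simps)

lemma reflection_conj:
  assumes "\<alpha> \<in> roots D"
  shows "reflection D (reflection D \<alpha> \<gamma>) (reflection D \<alpha> v) = reflection D \<alpha> (reflection D \<gamma> v)"
proof -
  have "reflection D \<alpha> (reflection D \<gamma> v) =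
      reflection D \<alpha> v - pairing D v \<gamma> *\<^sub>R reflection D \<alpha> \<gamma>"
    by (simp add: reflection_def[of D \<gamma>] linear_diff[OF linear_reflection]
        linear_scale[OF linear_reflection])
  then show ?thesis
    by (simp add: reflection_def[of D "reflection D \<alpha> \<gamma>"] pairing_reflection[OF assms])
qed

lemma reflection_uminus: "reflection D (- \<gamma>) = reflection D \<gamma>"
  by (simp add: fun_eq_iff reflection_def pairing_def coroot_def form_simps)

text \<open>
  A Weyl-invariant positive definite form that yields the same pairings; it replaces the
  given form, which may be indefinite a priori, in the length arguments.
\<close>

definition bform :: "'v \<Rightarrow> 'v \<Rightarrow> real" where
  "bform u v = (\<Sum>\<gamma>\<in>roots D. pairing D u \<gamma> * pairing D v \<gamma>)"

lemma bform_sym: "bform u v = bform v u"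
  by (simp add: bform_def mult.commute)

lemma bform_simps:
  "bform (u + v) w = bform u w + bform v w"
  "bform (u - v) w = bform u w - bform v w"
  "bform w (u + v) = bform w u + bform w v"
  "bform w (u - v) = bform w u - bform w v"
  "bform (c *\<^sub>R u) w = c * bform u w"
  "bform w (c *\<^sub>R u) = c * bform w u"
  "bform w (- u) = - bform w u"
  by (simp_all add: bform_def pairing_simps algebra_simps sum.distrib sum_subtractf
      sum_distrib_left sum_negf)

lemma linear_bform: "linear (bform u)"
  by (auto intro!: linearI simp: bform_simps)

text \<open>A sum of squares that is at most 0 makes every pairing of u with a root vanish. The
  roots span, so u is orthogonal to everything in the given form, which is nondegenerate.\<close>

lemma bform_definite: "bform u u \<le> 0 \<Longrightarrow> u = 0"
proof (rule form_nondegenerate)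
  fix v
  assume "bform u u \<le> 0"
  then have "bform u u = 0"
    by (simp add: bform_def order_antisym sum_nonneg)
  then have "pairing D u \<gamma> = 0" if "\<gamma> \<in> roots D" for \<gamma>
    using that finite_roots by (auto simp: bform_def sum_nonneg_eq_0_iff)
  then have orth: "form D u \<gamma> = 0" if "\<gamma> \<in> roots D" for \<gamma>
    using that nonisotropic[of \<gamma>] by (auto simp: pairing_def coroot_def form_simps)
  have lin: "linear (form D u)"
    by (auto intro!: linearI simp: form_simps)
  show "form D u v = 0"
    by (rule linear_eq_0_on_span[OF lin orth, of "roots D"]) (auto simp: span_roots)
qed

lemma bform_root_pos: "\<alpha> \<in> roots D \<Longrightarrow> 0 < bform \<alpha> \<alpha>"
  using bform_definite[of \<alpha>] root_nonzero[of \<alpha>] by fastforce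

lemma bform_reflection:
  assumes "\<alpha> \<in> roots D"
  shows "bform (reflection D \<alpha> u) (reflection D \<alpha> v) = bform u v"
proof -
  have inj: "inj_on (reflection D \<alpha>) (roots D)"
    using bij_reflection[OF assms] by (auto simp: bij_def inj_on_def)
  have "bform (reflection D \<alpha> u) (reflection D \<alpha> v) =
      (\<Sum>\<gamma>\<in>reflection D \<alpha> ` roots D. pairing D (reflection D \<alpha> u) \<gamma> * pairing D (reflection D \<alpha> v) \<gamma>)"
    by (simp only: bform_def reflection_image_roots[OF assms])
  also have "\<dots> = bform u v"
    by (simp add: sum.reindex[OF inj] pairing_reflection[OF assms] bform_def)
  finally show ?thesis .
qed

text \<open>Expanding the invariance of \<open>bform\<close> under the reflection, applied to v and
  \<alpha>, gives this. It lets the sign of a pairing be read off from the positive definite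
  form.\<close>

lemma pairing_bform:
  assumes "\<alpha> \<in> roots D"
  shows "pairing D v \<alpha> * bform \<alpha> \<alpha> = 2 * bform v \<alpha>"
  using bform_reflection[OF assms, of v \<alpha>]
  by (simp add: reflection_self[OF assms]) (simp add: reflection_def bform_simps)

section \<open>Positive and simple roots\<close>

definition height :: "'v \<Rightarrow> real" where
  "height = (SOME f. linear f \<and> (\<forall>\<alpha>\<in>roots D. f \<alpha> \<noteq> 0) \<and> pos D = {\<alpha> \<in> roots D. 0 < f \<alpha>})"

lemma height:
  "linear height" "\<alpha> \<in> roots D \<Longrightarrow> height \<alpha> \<noteq> 0" "pos D = {\<alpha> \<in> roots D. 0 < height \<alpha>}"
  using someI_ex[OF positive_system] by (simp_all add: height_def)

lemma pos_subset: "pos D \<subseteq> roots D"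
  by (auto simp: height(3))

lemma finite_pos: "finite (pos D)"
  using finite_roots pos_subset by (rule finite_subset[rotated])

lemma simple_subset: "simple_roots D \<subseteq> pos D"
  by (auto simp: simple_roots_def)

lemma simple_pos: "\<alpha> \<in> simple_roots D \<Longrightarrow> \<alpha> \<in> pos D"
  by (auto simp: simple_roots_def)

lemma simple_root: "\<alpha> \<in> simple_roots D \<Longrightarrow> \<alpha> \<in> roots D"
  using simple_subset pos_subset by auto

lemma finite_simple: "finite (simple_roots D)"
  using finite_pos simple_subset by (rule finite_subset[rotated])

lemma height_pos: "\<alpha> \<in> pos D \<Longrightarrow> 0 < height \<alpha>"
  by (simp add: height(3))

lemma uminus_pos_iff: "\<alpha> \<in> roots D \<Longrightarrow> - \<alpha> \<in> pos D \<longleftrightarrow> \<alpha> \<notin> pos D"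
  using height(2)[of \<alpha>] uminus_roots[of \<alpha>] linear_neg[OF height(1), of \<alpha>]
  by (auto simp: height(3))

text \<open>\<open>height\<close> is an arbitrary real functional cutting out the positive system,
  so its order is not well-founded by itself; the induction counts the finitely many positive roots
  of smaller height.\<close>

lemma pos_induct [consumes 1, case_names less]:
  assumes "\<beta> \<in> pos D"
    and "\<And>\<beta>. \<beta> \<in> pos D \<Longrightarrow> (\<And>\<gamma>. \<gamma> \<in> pos D \<Longrightarrow> height \<gamma> < height \<beta> \<Longrightarrow> P \<gamma>) \<Longrightarrow> P \<beta>"
  shows "P \<beta>"
  using assms(1)
proof (induction "card {\<gamma> \<in> pos D. height \<gamma> < height \<beta>}" arbitrary: \<beta> rule: less_induct)
  case less
  show ?case
  proof (rule assms(2)[OF less.prems])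
    fix \<gamma>
    assume \<gamma>: "\<gamma> \<in> pos D" "height \<gamma> < height \<beta>"
    then have "{\<delta> \<in> pos D. height \<delta> < height \<gamma>} \<subset> {\<delta> \<in> pos D. height \<delta> < height \<beta>}"
      by auto
    then show "P \<gamma>"
      using less.hyps[OF psubset_card_mono \<gamma>(1)] finite_pos by auto
  qed
qed

text \<open>A positive root that is not simple splits into two positive roots, both of smaller
  height.\<close>

lemma pos_simple_combination:
  assumes "\<beta> \<in> pos D"
  shows "\<exists>c::'v \<Rightarrow> nat. \<beta> = (\<Sum>\<alpha>\<in>simple_roots D. real (c \<alpha>) *\<^sub>R \<alpha>)"
  using assms
proof (induction rule: pos_induct)
  case (less \<beta>)
  show ?case
  proof (cases "\<beta> \<in> simple_roots D")
    case True
    have "(\<Sum>\<alpha>\<in>simple_roots D. real (if \<alpha> = \<beta> then 1 else 0) *\<^sub>R \<alpha>) =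
        (\<Sum>\<alpha>\<in>simple_roots D. if \<alpha> = \<beta> then \<beta> else 0)"
      by (rule sum.cong) auto
    with True finite_simple show ?thesis
      by (intro exI[of _ "\<lambda>\<alpha>. if \<alpha> = \<beta> then 1 else 0"]) (simp add: sum.delta)
  next
    case False
    with less.hyps obtain \<gamma> \<delta> where \<gamma>\<delta>: "\<gamma> \<in> pos D" "\<delta> \<in> pos D" "\<beta> = \<gamma> + \<delta>"
      by (auto simp: simple_roots_def)
    then have "height \<gamma> < height \<beta>" "height \<delta> < height \<beta>"
      using height_pos by (auto simp: linear_add[OF height(1)])
    with \<gamma>\<delta> less.IH obtain c d :: "'v \<Rightarrow> nat" where
      "\<gamma> = (\<Sum>\<alpha>\<in>simple_roots D. real (c \<alpha>) *\<^sub>R \<alpha>)"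
      "\<delta> = (\<Sum>\<alpha>\<in>simple_roots D. real (d \<alpha>) *\<^sub>R \<alpha>)"
      by metis
    with \<gamma>\<delta>(3) show ?thesis
      by (intro exI[of _ "\<lambda>\<alpha>. c \<alpha> + d \<alpha>"]) (simp add: scaleR_add_left sum.distrib)
  qed
qed

text \<open>Either the difference or its negative would be positive, and would decompose one of the
  two simple roots.\<close>

lemma simple_not_diff:
  assumes "\<alpha> \<in> simple_roots D" "\<beta> \<in> simple_roots D"
  shows "\<alpha> - \<beta> \<notin> roots D"
proof
  assume *: "\<alpha> - \<beta> \<in> roots D"
  have simple: False if "\<gamma> \<in> simple_roots D" "\<delta> \<in> pos D" "\<epsilon> \<in> pos D" "\<gamma> = \<delta> + \<epsilon>" for \<gamma> \<delta> \<epsilon>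
    using that unfolding simple_roots_def by blast
  show False
  proof (cases "\<alpha> - \<beta> \<in> pos D")
    case True
    with assms show False
      using simple[of \<alpha> \<beta> "\<alpha> - \<beta>"] simple_pos by simp
  next
    case False
    with * have "\<beta> - \<alpha> \<in> pos D"
      using uminus_pos_iff by fastforce
    with assms show False
      using simple[of \<beta> \<alpha> "\<beta> - \<alpha>"] simple_pos by simp
  qed
qed

text \<open>If one pairing is positive, so is the other, and both are integers. Neither is 1, as
  then a reflection would produce a root that is a difference of simple roots. With both at least 2,
  \<open>\<alpha> - \<beta>\<close> has nonpositive norm in \<open>bform\<close>, hence is
  zero.\<close>

lemma simple_obtuse:
  assumes "\<alpha> \<in> simple_roots D" "\<beta> \<in> simple_roots D" "\<alpha> \<noteq> \<beta>"
  shows "pairing D \<alpha> \<beta> \<le> 0"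
proof (rule ccontr)
  assume "\<not> ?thesis"
  then have n: "pairing D \<alpha> \<beta> > 0" by simp
  note r = assms(1,2)[THEN simple_root]
  have B: "pairing D \<alpha> \<beta> * bform \<beta> \<beta> = 2 * bform \<alpha> \<beta>" "pairing D \<beta> \<alpha> * bform \<alpha> \<alpha> = 2 * bform \<alpha> \<beta>"
    using pairing_bform[OF r(2), of \<alpha>] pairing_bform[OF r(1), of \<beta>] bform_sym[of \<alpha> \<beta>] by auto
  note Bp = bform_root_pos[OF r(1)] bform_root_pos[OF r(2)]
  from B(1) n Bp(2) have "bform \<alpha> \<beta> > 0"
    by (metis mult_pos_pos zero_less_mult_pos zero_less_numeral)
  with B(2) Bp(1) have m: "pairing D \<beta> \<alpha> > 0"
    by (metis mult_pos_pos zero_less_mult_pos2 zero_less_numeral)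
  have "pairing D \<alpha> \<beta> \<noteq> 1"
    using refl_roots[OF r(2,1)] simple_not_diff[OF assms(1,2)] by (auto simp: reflection_def)
  moreover have "pairing D \<beta> \<alpha> \<noteq> 1"
    using refl_roots[OF r] simple_not_diff[OF assms(2,1)] by (auto simp: reflection_def)
  moreover obtain k l :: int where kl: "pairing D \<alpha> \<beta> = k" "pairing D \<beta> \<alpha> = l"
    using integrality r by (meson Ints_cases)
  ultimately have "2 \<le> k" "2 \<le> l"
    using n m by auto
  then have nm: "2 \<le> pairing D \<alpha> \<beta>" "2 \<le> pairing D \<beta> \<alpha>"
    by (simp_all add: kl)
  have "2 * bform \<beta> \<beta> \<le> 2 * bform \<alpha> \<beta>"
    unfolding B(1)[symmetric] using nm Bp by (intro mult_right_mono) auto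
  moreover have "2 * bform \<alpha> \<alpha> \<le> 2 * bform \<alpha> \<beta>"
    unfolding B(2)[symmetric] using nm Bp by (intro mult_right_mono) auto
  ultimately have "bform (\<alpha> - \<beta>) (\<alpha> - \<beta>) \<le> 0"
    by (simp add: bform_simps bform_sym[of \<beta> \<alpha>])
  then have "\<alpha> - \<beta> = 0"
    by (rule bform_definite)
  with assms(3) show False by simp
qed

text \<open>Otherwise \<beta> and the negative of its reflection are nonnegative combinations of
  simple roots whose sum is a multiple of \<alpha>. Collecting the \<alpha>-terms gives
  \<open>n *\<^sub>R \<alpha>\<close> as a nonnegative combination of the other simple roots. If
  \<open>n \<le> 0\<close>, applying \<open>height\<close> kills all its coefficients, so \<beta> is
  a multiple of \<alpha>; if \<open>n > 0\<close>, pairing with \<alpha> contradicts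
  \<open>simple_obtuse\<close>.\<close>

lemma reflection_pos:
  assumes \<alpha>: "\<alpha> \<in> simple_roots D" and \<beta>: "\<beta> \<in> pos D" and neq: "\<beta> \<noteq> \<alpha>"
  shows "reflection D \<alpha> \<beta> \<in> pos D"
proof (rule ccontr)
  assume neg: "reflection D \<alpha> \<beta> \<notin> pos D"
  have r: "\<alpha> \<in> roots D" "\<beta> \<in> roots D" using \<alpha> \<beta> simple_root pos_subset by auto
  with neg have \<gamma>: "- reflection D \<alpha> \<beta> \<in> pos D"
    by (simp add: uminus_pos_iff refl_roots)
  obtain c d :: "'v \<Rightarrow> nat" where
    c: "\<beta> = (\<Sum>\<alpha>\<in>simple_roots D. real (c \<alpha>) *\<^sub>R \<alpha>)" and
    d: "- reflection D \<alpha> \<beta> = (\<Sum>\<alpha>\<in>simple_roots D. real (d \<alpha>) *\<^sub>R \<alpha>)"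
    using pos_simple_combination[OF \<beta>] pos_simple_combination[OF \<gamma>] by blast
  define S where "S = simple_roots D - {\<alpha>}"
  define e where "e \<delta> = real (c \<delta> + d \<delta>)" for \<delta>
  have S: "finite S" "\<alpha> \<notin> S" "simple_roots D = insert \<alpha> S"
    using finite_simple \<alpha> by (auto simp: S_def)
  define n where "n = pairing D \<beta> \<alpha> - e \<alpha>"
  have "pairing D \<beta> \<alpha> *\<^sub>R \<alpha> = \<beta> + (- reflection D \<alpha> \<beta>)"
    by (simp add: reflection_def)
  also have "\<dots> = (\<Sum>\<delta>\<in>simple_roots D. e \<delta> *\<^sub>R \<delta>)"
    unfolding d by (subst c) (simp add: e_def scaleR_add_left sum.distrib)
  also have "\<dots> = e \<alpha> *\<^sub>R \<alpha> + (\<Sum>\<delta>\<in>S. e \<delta> *\<^sub>R \<delta>)"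
    using S by simp
  finally have n: "n *\<^sub>R \<alpha> = (\<Sum>\<delta>\<in>S. e \<delta> *\<^sub>R \<delta>)"
    by (simp add: n_def scaleR_diff_left algebra_simps)
  show False
  proof (cases "n \<le> 0")
    case True
    have ht: "0 < height \<delta>" if "\<delta> \<in> simple_roots D" for \<delta>
      using that by (simp add: height_pos simple_pos)
    have "(\<Sum>\<delta>\<in>S. e \<delta> * height \<delta>) = n * height \<alpha>"
      using arg_cong[OF n, of height]
      by (simp add: linear_sum[OF height(1)] linear_scale[OF height(1)])
    also have "\<dots> \<le> 0"
      using True ht[OF \<alpha>] by (simp add: mult_nonpos_nonneg)
    finally have "(\<Sum>\<delta>\<in>S. e \<delta> * height \<delta>) = 0"
      using ht S by (intro antisym sum_nonneg mult_nonneg_nonneg) (auto simp: e_def less_imp_le)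
    then have "e \<delta> * height \<delta> = 0" if "\<delta> \<in> S" for \<delta>
      using ht S that by (subst (asm) sum_nonneg_eq_0_iff) (auto simp: e_def less_imp_le)
    then have "c \<delta> = 0" if "\<delta> \<in> S" for \<delta>
      using ht[of \<delta>] S that by (fastforce simp: e_def)
    then have \<beta>c: "\<beta> = real (c \<alpha>) *\<^sub>R \<alpha>"
      using c S by simp
    with reduced[OF r(1), of "real (c \<alpha>)"] r(2) have "real (c \<alpha>) = 1"
      by auto
    with \<beta>c neq show False by simp
  next
    case False
    have "2 * n = pairing D (n *\<^sub>R \<alpha>) \<alpha>"
      using r(1) by (simp add: pairing_simps pairing_self)
    also have "\<dots> = (\<Sum>\<delta>\<in>S. e \<delta> * pairing D \<delta> \<alpha>)"
      by (simp add: n linear_sum[OF linear_pairing] pairing_simps)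
    also have "\<dots> \<le> 0"
      using S simple_obtuse[OF _ \<alpha>] by (intro sum_nonpos mult_nonneg_nonpos) (auto simp: e_def)
    finally show False using False by simp
  qed
qed

subsection \<open>Reduced words\<close>

lemma word_prod_simps [simp]:
  "word_prod D [] = id"
  "word_prod D (a # u) = reflection D a \<circ> word_prod D u"
  by (simp_all add: word_prod_def)

lemma word_prod_append: "word_prod D (u @ v) = word_prod D u \<circ> word_prod D v"
  by (induction u) (auto simp: fun_eq_iff)

lemma word_prod_rev:
  assumes "set u \<subseteq> roots D"
  shows "word_prod D u \<circ> word_prod D (rev u) = id" "word_prod D (rev u) \<circ> word_prod D u = id"
  using assms by (induction u) (auto simp: word_prod_append fun_eq_iff)

lemma word_prod_weyl: "set u \<subseteq> roots D \<Longrightarrow> word_prod D u \<in> weyl D"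
  by (induction u) (auto intro: weyl.intros)

lemma linear_weyl: "w \<in> weyl D \<Longrightarrow> linear w"
proof (induction rule: weyl.induct)
  case weyl_id
  show ?case by (rule linear_id)
next
  case (weyl_reflection \<alpha> w)
  then show ?case by (intro linear_compose linear_reflection)
qed

lemma weyl_roots: "w \<in> weyl D \<Longrightarrow> \<beta> \<in> roots D \<Longrightarrow> w \<beta> \<in> roots D"
  by (induction rule: weyl.induct) (auto intro: refl_roots)

lemma weyl_comp: "v \<in> weyl D \<Longrightarrow> w \<in> weyl D \<Longrightarrow> v \<circ> w \<in> weyl D"
  by (induction rule: weyl.induct) (auto intro: weyl.intros simp: comp_assoc)

lemma weyl_refl: "\<alpha> \<in> roots D \<Longrightarrow> reflection D \<alpha> \<in> weyl D"
  using weyl_reflection[OF _ weyl_id] by fastforce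

text \<open>Weyl group elements are linear and the roots span, so each is determined by its
  restriction to the finite set of roots, which it maps to itself.\<close>

lemma finite_weyl: "finite (weyl D)"
proof (rule finite_imageD)
  show "finite ((\<lambda>w. restrict w (roots D)) ` weyl D)"
    by (rule finite_subset[OF _ finite_PiE[OF finite_roots finite_roots]])
      (auto intro: weyl_roots)
  show "inj_on (\<lambda>w. restrict w (roots D)) (weyl D)"
  proof (rule inj_onI, rule ext)
    fix v w x
    assume vw: "v \<in> weyl D" "w \<in> weyl D" "restrict v (roots D) = restrict w (roots D)"
    then have "v \<beta> = w \<beta>" if "\<beta> \<in> roots D" for \<beta>
      using that by (metis restrict_apply')
    then show "v x = w x"
      using linear_eq_on_span[of v w "roots D" x] vw(1,2) by (simp add: linear_weyl span_roots)
  qed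
qed

text \<open>Since \<beta> has positive norm and is a nonnegative combination of simple roots, some
  simple \<alpha> has positive product with it. Reflecting in \<alpha> lowers the height but keeps
  \<beta> positive, and conjugating the word of the smaller root by \<alpha> gives one for
  \<beta>.\<close>

lemma reflection_word:
  assumes "\<beta> \<in> pos D"
  shows "\<exists>u. set u \<subseteq> simple_roots D \<and> word_prod D u = reflection D \<beta>"
  using assms
proof (induction rule: pos_induct)
  case (less \<beta>)
  show ?case
  proof (cases "\<beta> \<in> simple_roots D")
    case True
    then show ?thesis by (intro exI[of _ "[\<beta>]"]) auto
  next
    case False
    obtain c :: "'v \<Rightarrow> nat" where c: "\<beta> = (\<Sum>\<alpha>\<in>simple_roots D. real (c \<alpha>) *\<^sub>R \<alpha>)"
      using pos_simple_combination[OF less.hyps] by blast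
    have r: "\<beta> \<in> roots D" using less.hyps pos_subset by auto
    have "bform \<beta> \<beta> = (\<Sum>\<alpha>\<in>simple_roots D. real (c \<alpha>) * bform \<beta> \<alpha>)"
      by (subst (2) c) (simp add: linear_sum[OF linear_bform] bform_simps)
    with bform_root_pos[OF r] have "\<not> (\<forall>\<alpha>\<in>simple_roots D. bform \<beta> \<alpha> \<le> 0)"
      by (metis (no_types, lifting) not_less of_nat_0_le_iff mult_nonneg_nonpos sum_nonpos)
    then obtain \<alpha> where \<alpha>: "\<alpha> \<in> simple_roots D" "bform \<beta> \<alpha> > 0"
      by force
    have "pairing D \<beta> \<alpha> > 0"
      using pairing_bform[of \<alpha> \<beta>] bform_root_pos[of \<alpha>] simple_root \<alpha>
      by (metis mult_pos_pos zero_less_mult_pos2 zero_less_numeral)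
    then have "height (reflection D \<alpha> \<beta>) < height \<beta>"
      using height_pos[OF simple_pos[OF \<alpha>(1)]]
      by (simp add: reflection_def linear_diff[OF height(1)] linear_scale[OF height(1)])
    moreover have "reflection D \<alpha> \<beta> \<in> pos D"
      using reflection_pos[OF \<alpha>(1) less.hyps] False \<alpha>(1) by auto
    ultimately obtain u where u: "set u \<subseteq> simple_roots D"
      "word_prod D u = reflection D (reflection D \<alpha> \<beta>)"
      using less.IH by blast
    have "word_prod D (\<alpha> # u @ [\<alpha>]) = reflection D \<beta>"
      using simple_root[OF \<alpha>(1)] reflection_conj[of \<alpha> \<beta>]
      by (auto simp: word_prod_append u fun_eq_iff)
    with u \<alpha>(1) show ?thesis
      by (intro exI[of _ "\<alpha> # u @ [\<alpha>]"]) auto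
  qed
qed

lemma weyl_word:
  assumes "w \<in> weyl D"
  shows "\<exists>u. set u \<subseteq> simple_roots D \<and> word_prod D u = w"
  using assms
proof (induction rule: weyl.induct)
  case weyl_id
  then show ?case by (intro exI[of _ "[]"]) auto
next
  case (weyl_reflection \<beta> w)
  have "\<exists>v. set v \<subseteq> simple_roots D \<and> word_prod D v = reflection D \<beta>"
    using reflection_word[of \<beta>] reflection_word[of "- \<beta>"] uminus_pos_iff[of \<beta>] weyl_reflection.hyps
    by (cases "\<beta> \<in> pos D") (auto simp: reflection_uminus)
  with weyl_reflection.IH obtain u v where "set u \<subseteq> simple_roots D" "word_prod D u = w"
    "set v \<subseteq> simple_roots D" "word_prod D v = reflection D \<beta>"
    by blast
  then show ?case
    by (intro exI[of _ "v @ u"]) (auto simp: word_prod_append)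
qed

lemma simple_words: "set u \<subseteq> simple_roots D \<Longrightarrow> set u \<subseteq> roots D"
  using simple_root by auto

section \<open>Length, exchange condition and descents\<close>

lemma len_le: "set u \<subseteq> simple_roots D \<Longrightarrow> len D (word_prod D u) \<le> length u"
  unfolding len_def by (rule Least_le) blast

lemma ex_reduced_word:
  assumes "w \<in> weyl D"
  shows "\<exists>u. reduced_word D w u"
proof -
  have "\<exists>p u. set u \<subseteq> simple_roots D \<and> word_prod D u = w \<and> length u = p"
    using weyl_word[OF assms] by blast
  from LeastI_ex[OF this] show ?thesis
    unfolding reduced_word_def len_def by blast
qed

lemma reduced_wordD:
  assumes "reduced_word D w u"
  shows "set u \<subseteq> simple_roots D" "word_prod D u = w" "length u = len D w"
  using assms by (auto simp: reduced_word_def)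

text \<open>
  The exchange condition in a form that locates the reflection: deleting the letter \<open>p\<close> of \<open>u\<close>
  amounts to multiplying by the reflection of \<open>\<beta>\<close>.
\<close>

lemma exchange:
  assumes "set u \<subseteq> simple_roots D" "\<beta> \<in> pos D" "word_prod D (rev u) \<beta> \<notin> pos D"
  shows "\<exists>p<length u. reflection D \<beta> \<circ> word_prod D (take p u) = word_prod D (take (Suc p) u)"
  using assms
proof (induction u arbitrary: \<beta>)
  case Nil
  then show ?case by simp
next
  case (Cons a u)
  have a: "a \<in> simple_roots D" "a \<in> roots D" using Cons.prems simple_root by auto
  show ?case
  proof (cases "\<beta> = a")
    case True
    then show ?thesis by (intro exI[of _ 0]) auto
  next
    case False
    \<comment> \<open>As \<beta> differs from the simple root a, its reflection in a is still
      positive and can take its place in the induction hypothesis; conjugation by that reflection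
      then leads back to \<beta>.\<close>
    have "word_prod D (rev u) (reflection D a \<beta>) \<notin> pos D" "set u \<subseteq> simple_roots D"
      using Cons.prems by (simp_all add: word_prod_append)
    then obtain p where p: "p < length u"
      "reflection D (reflection D a \<beta>) \<circ> word_prod D (take p u) = word_prod D (take (Suc p) u)"
      using Cons.IH reflection_pos[OF a(1) Cons.prems(2) False] by blast
    have "reflection D \<beta> \<circ> word_prod D (take (Suc p) (a # u)) =
        reflection D a \<circ> (reflection D (reflection D a \<beta>) \<circ> word_prod D (take p u))"
      using reflection_conj[OF a(2), of \<beta> "reflection D a y" for y] a(2)
      by (simp add: fun_eq_iff)
    also have "\<dots> = word_prod D (take (Suc (Suc p)) (a # u))"
      unfolding p(2) by simp
    finally have "reflection D \<beta> \<circ> word_prod D (take (Suc p) (a # u)) = word_prod D (take (Suc (Suc p)) (a # u))" .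
    moreover have "Suc p < length (a # u)"
      using p(1) by simp
    ultimately show ?thesis
      by blast
  qed
qed

lemma exchange_delete:
  assumes "\<alpha> \<in> roots D"
    and "reflection D \<alpha> \<circ> word_prod D (take p u) = word_prod D (take (Suc p) u)"
  shows "reflection D \<alpha> \<circ> word_prod D u = word_prod D (take p u @ drop (Suc p) u)"
proof -
  have "reflection D \<alpha> \<circ> word_prod D u =
      reflection D \<alpha> \<circ> (word_prod D (take (Suc p) u) \<circ> word_prod D (drop (Suc p) u))"
    by (simp flip: word_prod_append)
  also have "\<dots> = word_prod D (take p u) \<circ> word_prod D (drop (Suc p) u)"
    unfolding assms(2)[symmetric] using assms(1) by (simp add: fun_eq_iff)
  finally show ?thesis
    by (simp add: word_prod_append)
qed

lemma set_take_drop: "set (take p u @ drop n u) \<subseteq> set u"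
  by (auto dest: in_set_takeD in_set_dropD)

text \<open>\<open>word_prod D (rev u)\<close> is the inverse of \<open>word_prod D u\<close>. When
  it makes \<alpha> negative, multiplying by the reflection deletes a letter of u. The word u may be
  non-reduced.\<close>

lemma len_descent:
  assumes "set u \<subseteq> simple_roots D" "\<alpha> \<in> simple_roots D" "word_prod D (rev u) \<alpha> \<notin> pos D"
  shows "len D (reflection D \<alpha> \<circ> word_prod D u) < length u"
proof -
  obtain p where p: "p < length u"
    "reflection D \<alpha> \<circ> word_prod D (take p u) = word_prod D (take (Suc p) u)"
    using exchange[OF assms(1) simple_pos[OF assms(2)] assms(3)] by blast
  have "reflection D \<alpha> \<circ> word_prod D u = word_prod D (take p u @ drop (Suc p) u)"
    using exchange_delete[OF simple_root[OF assms(2)] p(2)] .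
  moreover have "len D \<dots> \<le> length (take p u @ drop (Suc p) u)"
    using assms(1) set_take_drop[of p u "Suc p"] by (intro len_le) blast
  ultimately show ?thesis
    using p(1) by simp
qed

lemma len_reflection_le:
  assumes "w \<in> weyl D" "\<alpha> \<in> simple_roots D"
  shows "len D (reflection D \<alpha> \<circ> w) \<le> Suc (len D w)"
proof -
  obtain u where u: "reduced_word D w u" using ex_reduced_word[OF assms(1)] by blast
  then show ?thesis
    using len_le[of "\<alpha> # u"] assms(2) by (auto simp: reduced_word_def)
qed

text \<open>The descent criterion applied to the product with the reflection, whose inverse sends
  \<alpha> to the negative of its former image.\<close>

lemma len_ascent:
  assumes "set u \<subseteq> simple_roots D" "\<alpha> \<in> simple_roots D" "word_prod D (rev u) \<alpha> \<in> pos D"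
  shows "len D (word_prod D u) < len D (reflection D \<alpha> \<circ> word_prod D u)"
proof -
  note r = simple_root[OF assms(2)]
  have "reflection D \<alpha> \<circ> word_prod D u \<in> weyl D"
    using word_prod_weyl[OF simple_words[OF assms(1)]] r by (auto intro: weyl.intros)
  then obtain v where v: "set v \<subseteq> simple_roots D" "word_prod D v = reflection D \<alpha> \<circ> word_prod D u"
    "length v = len D (reflection D \<alpha> \<circ> word_prod D u)"
    using ex_reduced_word reduced_wordD by blast
  note lin = linear_weyl[OF word_prod_weyl[of "rev v"]]
  have "word_prod D (rev v) \<circ> (word_prod D v \<circ> word_prod D (rev u)) = word_prod D (rev v) \<circ> reflection D \<alpha>"
    using word_prod_rev(1)[OF simple_words[OF assms(1)]] by (simp add: v(2) comp_assoc)
  then have "word_prod D (rev u) = word_prod D (rev v) \<circ> reflection D \<alpha>"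
    using word_prod_rev(2)[OF simple_words[OF v(1)]] by (simp flip: comp_assoc)
  then have "word_prod D (rev u) \<alpha> = - word_prod D (rev v) \<alpha>"
    using r lin simple_words[OF v(1)] by (simp add: reflection_self linear_neg)
  then have "word_prod D (rev v) \<alpha> \<notin> pos D"
    using assms(3) weyl_roots[OF word_prod_weyl[of "rev v"] r] simple_words[OF v(1)]
      uminus_pos_iff[of "word_prod D (rev v) \<alpha>"] by simp
  then have "len D (reflection D \<alpha> \<circ> word_prod D v) < length v"
    by (rule len_descent[OF v(1) assms(2)])
  moreover have "reflection D \<alpha> \<circ> word_prod D v = word_prod D u"
    using r v(2) by (auto simp: fun_eq_iff)
  ultimately show ?thesis
    using v(3) by simp
qed

lemma len_reflection:
  assumes "w \<in> weyl D" "\<alpha> \<in> simple_roots D"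
  shows "len D (reflection D \<alpha> \<circ> w) = Suc (len D w) \<or> len D w = Suc (len D (reflection D \<alpha> \<circ> w))"
proof -
  note r = simple_root[OF assms(2)]
  have sw: "reflection D \<alpha> \<circ> w \<in> weyl D"
    using assms(1) r by (auto intro: weyl.intros)
  have ssw: "reflection D \<alpha> \<circ> (reflection D \<alpha> \<circ> w) = w"
    using r by (auto simp: fun_eq_iff)
  obtain u where u: "set u \<subseteq> simple_roots D" "word_prod D u = w" "length u = len D w"
    using ex_reduced_word[OF assms(1)] reduced_wordD by blast
  have "len D (reflection D \<alpha> \<circ> w) \<noteq> len D w"
    using len_descent[OF u(1) assms(2)] len_ascent[OF u(1) assms(2)] u
    by (cases "word_prod D (rev u) \<alpha> \<in> pos D") auto
  moreover have "len D (reflection D \<alpha> \<circ> w) \<le> Suc (len D w)" "len D w \<le> Suc (len D (reflection D \<alpha> \<circ> w))"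
    using len_reflection_le[OF assms] len_reflection_le[OF sw assms(2)] by (simp_all add: ssw)
  ultimately show ?thesis
    by linarith
qed

lemma len_rev:
  assumes "set u \<subseteq> simple_roots D"
  shows "len D (word_prod D (rev u)) = len D (word_prod D u)"
proof -
  have *: "len D (word_prod D (rev u)) \<le> len D (word_prod D u)" if u: "set u \<subseteq> simple_roots D" for u
  proof -
    obtain v where v: "set v \<subseteq> simple_roots D" "word_prod D v = word_prod D u"
      "length v = len D (word_prod D u)"
      using ex_reduced_word[OF word_prod_weyl[OF simple_words[OF u]]] reduced_wordD by blast
    have "word_prod D (rev u) = word_prod D (rev u) \<circ> (word_prod D v \<circ> word_prod D (rev v))"
      by (simp add: word_prod_rev(1)[OF simple_words[OF v(1)]])
    also have "\<dots> = word_prod D (rev v)"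
      using word_prod_rev(2)[OF simple_words[OF u]] by (simp add: v(2) flip: comp_assoc)
    finally show ?thesis
      using len_le[of "rev v"] v by simp
  qed
  from *[of u] *[of "rev u"] assms show ?thesis by simp
qed

text \<open>The left-handed version transported by inversion, which reverses words and preserves
  length.\<close>

lemma len_reflection_right:
  assumes "w \<in> weyl D" "\<alpha> \<in> simple_roots D"
  shows "len D (w \<circ> reflection D \<alpha>) = Suc (len D w) \<or> len D w = Suc (len D (w \<circ> reflection D \<alpha>))"
proof -
  obtain u where u: "set u \<subseteq> simple_roots D" "word_prod D u = w"
    using weyl_word[OF assms(1)] by blast
  have "len D (reflection D \<alpha> \<circ> word_prod D (rev u)) = len D (w \<circ> reflection D \<alpha>)"
    using len_rev[of "u @ [\<alpha>]"] u assms(2) by (simp add: word_prod_append)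
  moreover have "len D (word_prod D (rev u)) = len D w"
    using len_rev[OF u(1)] u(2) by simp
  moreover have "word_prod D (rev u) \<in> weyl D"
    using simple_words[OF u(1)] by (intro word_prod_weyl) auto
  ultimately show ?thesis
    using len_reflection[of "word_prod D (rev u)" \<alpha>] assms(2) by simp
qed

lemma bij_betw_reflection_left:
  assumes "\<alpha> \<in> roots D"
  shows "bij_betw (\<lambda>w. reflection D \<alpha> \<circ> w) (weyl D) (weyl D)"
  by (rule bij_betw_byWitness[where f' = "\<lambda>w. reflection D \<alpha> \<circ> w"])
    (use assms in \<open>auto intro: weyl.intros simp: fun_eq_iff\<close>)

lemma bij_betw_reflection_right:
  assumes "\<alpha> \<in> roots D"
  shows "bij_betw (\<lambda>w. w \<circ> reflection D \<alpha>) (weyl D) (weyl D)"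
  by (rule bij_betw_byWitness[where f' = "\<lambda>w. w \<circ> reflection D \<alpha>"])
    (use assms in \<open>auto intro: weyl_comp weyl_refl simp: fun_eq_iff\<close>)

section \<open>Inversions and the longest element\<close>

definition inversions :: "('v \<Rightarrow> 'v) \<Rightarrow> 'v set" where
  "inversions w = {\<beta> \<in> pos D. w \<beta> \<notin> pos D}"

text \<open>The reflection permutes the positive roots other than \<alpha>, so it carries the
  inversions of w to those of the product, and \<alpha> itself is the one new inversion.\<close>

lemma card_inversions_reflection:
  assumes w: "w \<in> weyl D" and \<alpha>: "\<alpha> \<in> simple_roots D" and pos: "w \<alpha> \<in> pos D"
  shows "card (inversions (w \<circ> reflection D \<alpha>)) = Suc (card (inversions w))"
proof -
  note r = simple_root[OF \<alpha>]
  have "w (reflection D \<alpha> \<alpha>) \<notin> pos D"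
    using linear_weyl[OF w] pos weyl_roots[OF w r] uminus_pos_iff[of "w \<alpha>"]
    by (simp add: reflection_self[OF r] linear_neg)
  then have "inversions (w \<circ> reflection D \<alpha>) = insert \<alpha> (reflection D \<alpha> ` inversions w)"
    using reflection_pos[OF \<alpha>] r pos simple_pos[OF \<alpha>]
    by (auto simp: inversions_def image_iff) (metis reflection_reflection)+
  moreover have "inj (reflection D \<alpha>)"
    using bij_reflection[OF r] by (simp add: bij_is_inj)
  moreover have "\<alpha> \<notin> reflection D \<alpha> ` inversions w"
    using reflection_self[OF r] reflection_reflection[OF r] uminus_pos_iff[OF r] simple_pos[OF \<alpha>]
    by (auto simp: inversions_def) (metis reflection_reflection)
  moreover have "finite (inversions w)"
    using finite_pos by (simp add: inversions_def)
  ultimately show ?thesis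
    by (simp add: card_image inj_on_subset)
qed

text \<open>The inverse appears because removing the first letter of u multiplies the inverse on the
  right, which is the side treated by \<open>card_inversions_reflection\<close>.\<close>

lemma length_inversions:
  assumes "reduced_word D w u"
  shows "length u = card (inversions (word_prod D (rev u)))"
  using assms
proof (induction u arbitrary: w)
  case Nil
  then show ?case by (simp add: inversions_def)
next
  case (Cons a u)
  note au = reduced_wordD[OF Cons.prems]
  have a: "a \<in> simple_roots D" and u: "set u \<subseteq> simple_roots D" using au by auto
  have uw: "word_prod D u \<in> weyl D" using simple_words[OF u] by (rule word_prod_weyl)
  have "len D (word_prod D u) = length u"
    using len_le[OF u] len_reflection_le[OF uw a] au by simp
  then have red: "reduced_word D (word_prod D u) u"
    using u by (simp add: reduced_word_def)
  have "word_prod D (rev u) a \<in> pos D"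
    using len_descent[OF u a] au by auto
  then have "card (inversions (word_prod D (rev u) \<circ> reflection D a)) = Suc (length u)"
    using card_inversions_reflection[of "word_prod D (rev u)" a] a simple_words[OF u]
      Cons.IH[OF red] by (simp add: word_prod_weyl)
  then show ?case
    by (simp add: word_prod_append comp_def)
qed

lemma len_inversions:
  assumes "w \<in> weyl D" "w \<circ> w' = id"
  shows "len D w = card (inversions w')"
proof -
  obtain u where u: "reduced_word D w u"
    using ex_reduced_word[OF assms(1)] by blast
  note uD = reduced_wordD[OF u]
  have "w' = word_prod D (rev u) \<circ> word_prod D u \<circ> w'"
    using word_prod_rev(2)[OF simple_words[OF uD(1)]] by simp
  also have "\<dots> = word_prod D (rev u)"
    using assms(2) by (simp add: uD(2) comp_assoc)
  finally show ?thesis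
    using length_inversions[OF u] uD(3) by simp
qed

text \<open>An element v of maximal length has only descents, so its inverse makes every simple
  root, hence every positive root, negative. Composing with that inverse exchanges inversions and
  non-inversions, which turns lengths into their complements.\<close>

lemma longest_element:
  "\<exists>v\<in>weyl D. \<forall>w\<in>weyl D. len D (v \<circ> w) + len D w = card (pos D)"
proof -
  have "Max (len D ` weyl D) \<in> len D ` weyl D"
    using finite_weyl weyl_id[of D] by (intro Max_in) auto
  then obtain v where v: "v \<in> weyl D" "Max (len D ` weyl D) = len D v"
    by blast
  have max: "len D w \<le> len D v" if "w \<in> weyl D" for w
    unfolding v(2)[symmetric] using finite_weyl that by simp
  note v = v(1)
  obtain u where u: "set u \<subseteq> simple_roots D" "word_prod D u = v"
    using weyl_word[OF v] by blast
  have ur: "set u \<subseteq> roots D" by (rule simple_words[OF u(1)])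
  define v' where "v' = word_prod D (rev u)"
  have v': "v' \<in> weyl D" using ur by (simp add: v'_def word_prod_weyl)
  have vv': "v \<circ> v' = id" "v' \<circ> v = id"
    using word_prod_rev[OF ur] u(2) by (simp_all add: v'_def)
  \<comment> \<open>A positive image would be an ascent, against the maximality of v.\<close>
  have "v' \<alpha> \<notin> pos D" if "\<alpha> \<in> simple_roots D" for \<alpha>
    using len_ascent[OF u(1) that] max[OF weyl_reflection[OF simple_root[OF that] v]] u(2)
    by (auto simp: v'_def)
  then have simple_neg: "height (v' \<alpha>) \<le> 0" if "\<alpha> \<in> simple_roots D" for \<alpha>
    using that weyl_roots[OF v' simple_root[OF that]] by (force simp: height(3))
  have neg: "v' \<beta> \<notin> pos D" if \<beta>: "\<beta> \<in> pos D" for \<beta>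
  proof -
    obtain c :: "'v \<Rightarrow> nat" where c: "\<beta> = (\<Sum>\<alpha>\<in>simple_roots D. real (c \<alpha>) *\<^sub>R \<alpha>)"
      using pos_simple_combination[OF \<beta>] by blast
    have "height (v' \<beta>) = (\<Sum>\<alpha>\<in>simple_roots D. real (c \<alpha>) * height (v' \<alpha>))"
      by (subst c) (simp add: linear_sum[OF linear_weyl[OF v']] linear_sum[OF height(1)]
          linear_scale[OF linear_weyl[OF v']] linear_scale[OF height(1)])
    also have "\<dots> \<le> 0"
      using simple_neg by (intro sum_nonpos mult_nonneg_nonpos) auto
    finally show ?thesis
      using height_pos by fastforce
  qed
  define f where "f \<beta> = - v' \<beta>" for \<beta>
  have inj: "inj f"
  proof (rule injI)
    fix x y
    assume "f x = f y"
    then have "v (v' x) = v (v' y)" by (simp add: f_def)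
    then show "x = y" using fun_cong[OF vv'(1)] by simp
  qed
  \<comment> \<open>By \<open>neg\<close> the sign in f maps positive roots to positive roots, and
    an injective self-map of a finite set is onto.\<close>
  have f_pos: "f ` pos D = pos D"
    using neg weyl_roots[OF v'] pos_subset uminus_pos_iff inj
    by (intro endo_inj_surj[OF finite_pos]) (auto simp: f_def inj_on_def inj_def)
  show ?thesis
  proof (intro bexI[OF _ v] ballI)
    fix w
    assume w: "w \<in> weyl D"
    obtain x where x: "set x \<subseteq> simple_roots D" "word_prod D x = w"
      using weyl_word[OF w] by blast
    have xr: "set x \<subseteq> roots D" by (rule simple_words[OF x(1)])
    define w' where "w' = word_prod D (rev x)"
    have w': "w' \<in> weyl D" using xr by (simp add: w'_def word_prod_weyl)
    have ww': "w \<circ> w' = id"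
      using word_prod_rev[OF xr] x(2) by (simp add: w'_def)
    have "v \<circ> w \<circ> (w' \<circ> v') = v \<circ> (w \<circ> w') \<circ> v'"
      by (simp only: comp_assoc)
    also have "\<dots> = id"
      by (simp add: ww' vv')
    finally have len_vw: "len D (v \<circ> w) = card (inversions (w' \<circ> v'))"
      by (rule len_inversions[OF weyl_comp[OF v w]])
    \<comment> \<open>So f maps the inversions of \<open>w' \<circ> v'\<close> bijectively to the
      positive roots that are not inversions of \<open>w'\<close>.\<close>
    have "w' (v' \<beta>) \<notin> pos D \<longleftrightarrow> w' (f \<beta>) \<in> pos D" if "\<beta> \<in> pos D" for \<beta>
      using that pos_subset uminus_pos_iff[OF weyl_roots[OF w' weyl_roots[OF v'], of \<beta>]]
      by (auto simp: f_def linear_neg[OF linear_weyl[OF w']])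
    then have "inversions (w' \<circ> v') = {\<beta> \<in> pos D. w' (f \<beta>) \<in> pos D}"
      by (auto simp: inversions_def)
    then have "f ` inversions (w' \<circ> v') = f ` pos D \<inter> {\<gamma>. w' \<gamma> \<in> pos D}"
      by auto
    also have "\<dots> = pos D - inversions w'"
      by (auto simp: f_pos inversions_def)
    finally have "card (pos D - inversions w') = card (inversions (w' \<circ> v'))"
      using card_image[OF inj_on_subset[OF inj]] by (metis subset_UNIV)
    moreover have "card (pos D - inversions w') + card (inversions w') = card (pos D)"
      using finite_pos card_mono[OF finite_pos, of "inversions w'"]
      by (subst card_Diff_subset) (auto simp: inversions_def)
    ultimately show "len D (v \<circ> w) + len D w = card (pos D)"
      using len_vw len_inversions[OF w ww'] by simp
  qed
qed

subsection \<open>Matsumoto's theorem\<close>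

lemma length_alternating [simp]: "length (alternating a b n) = n"
  by (induction a b n rule: alternating.induct) auto

lemma set_alternating: "set (alternating a b n) \<subseteq> {a, b}"
  by (induction a b n rule: alternating.induct) auto

lemma take_alternating: "p \<le> n \<Longrightarrow> take p (alternating a b n) = alternating a b p"
proof (induction a b n arbitrary: p rule: alternating.induct)
  case (2 a b n)
  then show ?case by (cases p) auto
qed simp

lemma funpow_comp_conj: "f \<circ> (g \<circ> f) ^^ n \<circ> g = (f \<circ> g) ^^ Suc n"
proof (induction n)
  case (Suc n)
  have "f \<circ> (g \<circ> f) ^^ Suc n \<circ> g = (f \<circ> g) \<circ> (f \<circ> (g \<circ> f) ^^ n \<circ> g)"
    by (simp only: funpow.simps comp_assoc)
  also have "\<dots> = (f \<circ> g) ^^ Suc (Suc n)"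
    unfolding Suc by (simp only: funpow.simps)
  finally show ?case .
qed simp

text \<open>The reversed word is the inverse of \<open>alternating \<beta> \<alpha> n\<close>, so
  the power on the right measures the failure of the braid relation of length n.\<close>

lemma alternating_rev:
  "word_prod D (alternating \<alpha> \<beta> n) \<circ> word_prod D (rev (alternating \<beta> \<alpha> n)) =
    (reflection D \<alpha> \<circ> reflection D \<beta>) ^^ n"
proof (induction n arbitrary: \<alpha> \<beta>)
  case (Suc n)
  have "word_prod D (alternating \<alpha> \<beta> (Suc n)) \<circ> word_prod D (rev (alternating \<beta> \<alpha> (Suc n))) =
      reflection D \<alpha> \<circ> (word_prod D (alternating \<beta> \<alpha> n) \<circ> word_prod D (rev (alternating \<alpha> \<beta> n))) \<circ>
      reflection D \<beta>"
    by (simp add: word_prod_append comp_assoc)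
  also have "\<dots> = (reflection D \<alpha> \<circ> reflection D \<beta>) ^^ Suc n"
    unfolding Suc by (rule funpow_comp_conj)
  finally show ?case .
qed simp

lemma alternating_eq_iff:
  assumes "\<alpha> \<in> roots D" "\<beta> \<in> roots D"
  shows "word_prod D (alternating \<alpha> \<beta> n) = word_prod D (alternating \<beta> \<alpha> n) \<longleftrightarrow>
    (reflection D \<alpha> \<circ> reflection D \<beta>) ^^ n = id"
proof -
  have "set (alternating \<beta> \<alpha> n) \<subseteq> roots D"
    using assms set_alternating[of \<beta> \<alpha> n] by auto
  note inv = word_prod_rev[OF this]
  have "word_prod D (alternating \<alpha> \<beta> n) = word_prod D (alternating \<beta> \<alpha> n)"
    if "word_prod D (alternating \<alpha> \<beta> n) \<circ> word_prod D (rev (alternating \<beta> \<alpha> n)) = id"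
    using arg_cong[OF that, of "\<lambda>f. f \<circ> word_prod D (alternating \<beta> \<alpha> n)"] inv(2)
    by (simp add: comp_assoc)
  then show ?thesis
    using inv(1) unfolding alternating_rev[symmetric] by metis
qed

text \<open>Makes the \<open>LEAST\<close> in \<open>braid_order\<close> meaningful: the powers of
  the product lie in the finite Weyl group, so two of them coincide and cancelling leaves a positive
  power equal to the identity.\<close>

lemma braid_order:
  assumes "\<alpha> \<in> roots D" "\<beta> \<in> roots D"
  shows "0 < braid_order D \<alpha> \<beta>" "(reflection D \<alpha> \<circ> reflection D \<beta>) ^^ braid_order D \<alpha> \<beta> = id"
proof -
  define f where "f = reflection D \<alpha> \<circ> reflection D \<beta>"
  have f: "f \<in> weyl D" "bij f"
    using assms by (auto simp: f_def weyl_comp weyl_refl bij_reflection bij_comp)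
  have "f ^^ n \<in> weyl D" for n
    using f(1) by (induction n) (auto intro: weyl_comp weyl_id)
  then have "\<not> inj (\<lambda>n. f ^^ n)"
    using finite_weyl by (metis finite_imageD finite_subset image_subset_iff infinite_UNIV_nat)
  then obtain i j where ij: "i < j" "f ^^ i = f ^^ j"
    by (metis injI linorder_neqE_nat)
  then have "f ^^ i \<circ> f ^^ (j - i) = f ^^ i \<circ> id"
    by (metis comp_id funpow_add le_add_diff_inverse less_imp_le)
  moreover have "inj (f ^^ i)"
    using f(2) by (simp add: bij_is_inj inj_fn)
  ultimately have "f ^^ (j - i) = id"
    by (auto simp: fun_eq_iff inj_eq)
  with ij have "\<exists>m. 0 < m \<and> f ^^ m = id"
    by (intro exI[of _ "j - i"]) auto
  from LeastI_ex[OF this]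
  show "0 < braid_order D \<alpha> \<beta>" "(reflection D \<alpha> \<circ> reflection D \<beta>) ^^ braid_order D \<alpha> \<beta> = id"
    by (auto simp: braid_order_def f_def)
qed

lemma alternating_neq:
  assumes "\<alpha> \<in> roots D" "\<beta> \<in> roots D" "0 < p" "p < braid_order D \<alpha> \<beta>"
  shows "word_prod D (alternating \<alpha> \<beta> p) \<noteq> word_prod D (alternating \<beta> \<alpha> p)"
  using not_less_Least[OF assms(4)[unfolded braid_order_def]] assms(1-3)
  by (simp add: alternating_eq_iff)

text \<open>
  When both \<open>\<alpha>\<close> and \<open>\<beta>\<close> are left descents, the alternating prefix can be grown one letter at a
  time: the letter deleted by the exchange condition cannot lie in the prefix, since that would
  yield a relation between the two reflections shorter than the braid relation.
\<close>

lemma reduced_word_alternating_Suc: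
  assumes \<alpha>: "\<alpha> \<in> simple_roots D" and \<beta>: "\<beta> \<in> simple_roots D"
    and k: "k < n" "\<And>p. 0 < p \<Longrightarrow> p < n \<Longrightarrow> word_prod D (alternating \<alpha> \<beta> p) \<noteq> word_prod D (alternating \<beta> \<alpha> p)"
    and red: "reduced_word D w (alternating \<alpha> \<beta> k @ x)"
    and descent: "len D (reflection D \<beta> \<circ> w) < len D w"
  shows "\<exists>y. reduced_word D w (alternating \<beta> \<alpha> (Suc k) @ y)"
proof -
  define a where "a = alternating \<alpha> \<beta> k @ x"
  have a: "set a \<subseteq> simple_roots D" "word_prod D a = w" "length a = len D w"
    using reduced_wordD[OF red] by (simp_all add: a_def)
  have "word_prod D (rev a) \<beta> \<notin> pos D"
    using len_ascent[OF a(1) \<beta>] descent a by auto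
  then obtain p where p: "p < length a"
    "reflection D \<beta> \<circ> word_prod D (take p a) = word_prod D (take (Suc p) a)"
    using exchange[OF a(1) simple_pos[OF \<beta>]] by blast
  have "k \<le> p"
  proof (rule ccontr)
    assume "\<not> ?thesis"
    then have "take p a = alternating \<alpha> \<beta> p" "take (Suc p) a = alternating \<alpha> \<beta> (Suc p)"
      by (simp_all add: a_def take_alternating del: alternating.simps)
    with p(2) have "word_prod D (alternating \<beta> \<alpha> (Suc p)) = word_prod D (alternating \<alpha> \<beta> (Suc p))"
      by simp
    with k(2)[of "Suc p"] k(1) \<open>\<not> k \<le> p\<close> show False by simp
  qed
  define y where "y = take (p - k) x @ drop (Suc p) a"
  have y: "alternating \<beta> \<alpha> (Suc k) @ y = \<beta> # take p a @ drop (Suc p) a"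
    using \<open>k \<le> p\<close> by (simp add: y_def a_def)
  have "reflection D \<beta> \<circ> w = word_prod D (take p a @ drop (Suc p) a)"
    using exchange_delete[OF simple_root[OF \<beta>] p(2)] a(2) by simp
  then have "word_prod D (\<beta> # take p a @ drop (Suc p) a) = reflection D \<beta> \<circ> (reflection D \<beta> \<circ> w)"
    by simp
  also have "\<dots> = w"
    using simple_root[OF \<beta>] by (simp add: fun_eq_iff)
  finally have "word_prod D (\<beta> # take p a @ drop (Suc p) a) = w" .
  moreover have "set (\<beta> # take p a @ drop (Suc p) a) \<subseteq> simple_roots D"
    using \<beta> a(1) set_take_drop[of p a "Suc p"] by auto
  ultimately show ?thesis
    using p(1) a(3) by (intro exI[of _ y], unfold y) (auto simp: reduced_word_def)
qed

text \<open>Both halves are proved together because a prefix of length \<open>Suc k\<close> starting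
  with one root is grown from the prefix of length k starting with the other.\<close>

lemma reduced_word_alternating:
  assumes "w \<in> weyl D" "\<alpha> \<in> simple_roots D" "\<beta> \<in> simple_roots D"
    and "len D (reflection D \<alpha> \<circ> w) < len D w" "len D (reflection D \<beta> \<circ> w) < len D w"
    and "k \<le> braid_order D \<alpha> \<beta>"
  shows "(\<exists>x. reduced_word D w (alternating \<alpha> \<beta> k @ x)) \<and> (\<exists>x. reduced_word D w (alternating \<beta> \<alpha> k @ x))"
  using assms(6)
proof (induction k)
  case 0
  then show ?case using ex_reduced_word[OF assms(1)] by simp
next
  case (Suc k)
  then obtain x y where "reduced_word D w (alternating \<alpha> \<beta> k @ x)"
    "reduced_word D w (alternating \<beta> \<alpha> k @ y)"
    by auto
  with assms Suc.prems show ?case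
    using alternating_neq[OF simple_root[OF assms(2)] simple_root[OF assms(3)]]
      reduced_word_alternating_Suc[of \<alpha> \<beta> k "braid_order D \<alpha> \<beta>" w x]
      reduced_word_alternating_Suc[of \<beta> \<alpha> k "braid_order D \<alpha> \<beta>" w y]
    by (metis Suc_le_lessD)
qed

lemma reduced_word_Cons:
  assumes "reduced_word D w (a # u)"
  shows "reduced_word D (reflection D a \<circ> w) u" "len D w = Suc (len D (reflection D a \<circ> w))"
proof -
  note au = reduced_wordD[OF assms]
  have a: "a \<in> simple_roots D" and u: "set u \<subseteq> simple_roots D" using au by auto
  have "reflection D a \<circ> w = reflection D a \<circ> reflection D a \<circ> word_prod D u"
    using au(2) by (simp add: comp_assoc)
  then have w: "reflection D a \<circ> w = word_prod D u"
    by (simp add: reflection_comp_self simple_root[OF a])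
  have "len D w \<le> Suc (len D (word_prod D u))"
    using len_reflection_le[OF word_prod_weyl[OF simple_words[OF u]] a] au(2) by simp
  with len_le[OF u] au(3) have "len D (word_prod D u) = length u"
    by simp
  with au(3) u show "reduced_word D (reflection D a \<circ> w) u" "len D w = Suc (len D (reflection D a \<circ> w))"
    by (simp_all add: w reduced_word_def)
qed

text \<open>Stated for any equivalence that admits braid moves at the front and prefixing of
  letters, so that congruence of products of the generators can be inserted. Reduced words with
  equal first letter are related by induction. Words starting with distinct a and b are linked
  through reduced words that start with the two full alternating words and share a tail; each of
  these shares its first letter with one of the given words.\<close>

theorem matsumoto:
  assumes "equivp R"
    and Cons: "\<And>a u v. \<lbrakk>a \<in> simple_roots D; set u \<subseteq> simple_roots D; set v \<subseteq> simple_roots D; R u v\<rbrakk>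
      \<Longrightarrow> R (a # u) (a # v)"
    and braid: "\<And>\<alpha> \<beta> x. \<lbrakk>\<alpha> \<in> simple_roots D; \<beta> \<in> simple_roots D; \<alpha> \<noteq> \<beta>; set x \<subseteq> simple_roots D\<rbrakk>
      \<Longrightarrow> R (alternating \<alpha> \<beta> (braid_order D \<alpha> \<beta>) @ x) (alternating \<beta> \<alpha> (braid_order D \<alpha> \<beta>) @ x)"
    and "w \<in> weyl D" "reduced_word D w u" "reduced_word D w v"
  shows "R u v"
  using assms(4-6)
proof (induction "length u" arbitrary: w u v)
  case 0
  then show ?case
    using reduced_wordD(3) equivp_reflp[OF assms(1)] by (metis length_0_conv)
next
  case (Suc n)
  have "length v = length u"
    using Suc.prems reduced_wordD(3) by metis
  with Suc.hyps(2) obtain a u' b v' where uv: "u = a # u'" "v = b # v'"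
    by (metis length_Suc_conv)
  have a: "a \<in> simple_roots D" and b: "b \<in> simple_roots D"
    using reduced_wordD(1)[OF Suc.prems(2)] reduced_wordD(1)[OF Suc.prems(3)] by (auto simp: uv)
  have weyl: "reflection D c \<circ> w \<in> weyl D" if "c \<in> simple_roots D" for c
    using Suc.prems(1) simple_root[OF that] by (rule weyl_reflection[rotated])
  have same_letter: "R (c # x) (c # y)"
    if "reduced_word D w (c # x)" "reduced_word D w (c # y)" for c x y
  proof (rule Cons)
    show c: "c \<in> simple_roots D" and "set x \<subseteq> simple_roots D" "set y \<subseteq> simple_roots D"
      using reduced_wordD(1)[OF that(1)] reduced_wordD(1)[OF that(2)] by auto
    have "length x = n"
      using reduced_wordD(3)[OF that(1)] reduced_wordD(3)[OF Suc.prems(2)] Suc.hyps(2) by simp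
    then show "R x y"
      using Suc.hyps(1)[OF _ weyl[OF c] reduced_word_Cons(1)[OF that(1)] reduced_word_Cons(1)[OF that(2)]]
      by simp
  qed
  show ?case
  proof (cases "a = b")
    case True
    then show ?thesis
      using same_letter Suc.prems uv by simp
  next
    case False
    define m where "m = braid_order D a b"
    have m: "0 < m"
      using braid_order(1) a b simple_root by (simp add: m_def)
    then obtain m' where m': "m = Suc m'"
      using gr0_implies_Suc by blast
    have "len D (reflection D a \<circ> w) < len D w" "len D (reflection D b \<circ> w) < len D w"
      using reduced_word_Cons(2) Suc.prems(2,3) unfolding uv by (metis lessI)+
    then obtain x where x: "reduced_word D w (alternating a b m @ x)"
      using reduced_word_alternating[OF Suc.prems(1) a b] by (auto simp: m_def)
    \<comment> \<open>Both sides of the braid relation have equal product and length, so the same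
      tail x completes either one to a reduced word of w.\<close>
    have "word_prod D (alternating a b m) = word_prod D (alternating b a m)"
      using alternating_eq_iff braid_order(2) a b simple_root by (simp add: m_def)
    with x a b have y: "reduced_word D w (alternating b a m @ x)"
      using set_alternating[of b a m] by (auto simp: reduced_word_def word_prod_append)
    have "R u (alternating a b m @ x)"
      using same_letter[of a u' "alternating b a m' @ x"] Suc.prems(2) x by (simp add: uv m')
    moreover have "R (alternating a b m @ x) (alternating b a m @ x)"
      using braid[OF a b False] reduced_wordD(1)[OF x] by (simp add: m_def)
    moreover have "R (alternating b a m @ x) v"
      using same_letter[of b "alternating a b m' @ x" v'] Suc.prems(3) y by (simp add: uv m')
    ultimately show ?thesis
      using equivp_transp[OF assms(1)] by metis
  qed
qed

end

section \<open>The coefficient ring\<close>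

lemma q_power: "q ^ n = to_fract (monom 1 n)"
proof (induction n)
  case (Suc n)
  have "q ^ Suc n = to_fract (monom 1 1 * monom 1 n)"
    by (simp only: power_Suc Suc to_fract_mult) (simp only: q_def)
  then show ?case
    by (simp only: mult_monom) simp
qed simp

lemma q_nonzero [simp]: "q \<noteq> 0"
  by (simp add: q_def)

context root_system
begin

lemma poincare_to_fract: "poincare D (q\<^sup>2) = to_fract (\<Sum>w\<in>weyl D. monom 1 (2 * len D w))"
proof -
  have "(q\<^sup>2) ^ n = to_fract (monom 1 (2 * n))" for n
    unfolding power_mult[symmetric] by (rule q_power)
  then show ?thesis
    by (simp only: poincare_def to_fract_sum)
qed

text \<open>As a polynomial in q it takes the value \<open>card (weyl D)\<close> at 1, which is
  positive.\<close>

lemma poincare_nonzero: "poincare D (q\<^sup>2) \<noteq> 0"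
proof
  assume "poincare D (q\<^sup>2) = 0"
  then have "(\<Sum>w\<in>weyl D. monom (1::int) (2 * len D w)) = 0"
    by (simp only: poincare_to_fract to_fract_eq_0_iff)
  then have "poly (\<Sum>w\<in>weyl D. monom (1::int) (2 * len D w)) 1 = 0"
    by simp
  then show False
    using finite_weyl weyl_id[of D] by (auto simp: poly_sum poly_monom)
qed

text \<open>Left multiplication by the longest element permutes W and replaces each length by its
  complement to \<open>card (pos D)\<close>.\<close>

lemma poincare_inverse:
  fixes x :: ratfun
  assumes "x \<noteq> 0"
  shows "poincare D (inverse x) = inverse x ^ card (pos D) * poincare D x"
proof -
  obtain v where v: "v \<in> weyl D" "\<And>w. w \<in> weyl D \<Longrightarrow> len D (v \<circ> w) + len D w = card (pos D)"
    using longest_element by blast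
  obtain u where u: "set u \<subseteq> simple_roots D" "word_prod D u = v"
    using weyl_word[OF v(1)] by blast
  note inv = word_prod_rev[OF simple_words[OF u(1)], unfolded u(2)]
  have "word_prod D (rev u) \<in> weyl D"
    using simple_words[OF u(1)] by (intro word_prod_weyl) simp
  then have bij: "bij_betw (\<lambda>w. v \<circ> w) (weyl D) (weyl D)"
    using v(1) inv
    by (intro bij_betw_byWitness[where f' = "\<lambda>w. word_prod D (rev u) \<circ> w"])
      (auto intro: weyl_comp simp flip: comp_assoc)
  have "poincare D (inverse x) = (\<Sum>w\<in>weyl D. inverse x ^ len D (v \<circ> w))"
    unfolding poincare_def by (rule sum.reindex_bij_betw[OF bij, symmetric])
  also have "\<dots> = (\<Sum>w\<in>weyl D. inverse x ^ card (pos D) * x ^ len D w)"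
  proof (rule sum.cong[OF refl])
    fix w
    assume "w \<in> weyl D"
    then show "inverse x ^ len D (v \<circ> w) = inverse x ^ card (pos D) * x ^ len D w"
      using v(2)[of w, symmetric] assms by (simp add: power_add field_simps)
  qed
  finally show ?thesis
    by (simp add: poincare_def sum_distrib_left)
qed

lemma coeff_ringI: "to_fract p / (q ^ a * poincare D (q\<^sup>2) ^ b) \<in> coeff_ring D"
  unfolding coeff_ring_def by blast

lemma coeff_ringE:
  assumes "x \<in> coeff_ring D"
  obtains p a b where "x = to_fract p / (q ^ a * poincare D (q\<^sup>2) ^ b)"
  using assms unfolding coeff_ring_def by blast

lemma to_fract_power: "to_fract (x ^ n) = to_fract x ^ n"
  by (induction n) auto

lemma coeff_ring_add: "x \<in> coeff_ring D \<Longrightarrow> y \<in> coeff_ring D \<Longrightarrow> x + y \<in> coeff_ring D"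
proof (elim coeff_ringE)
  fix p a b p' a' b'
  assume xy: "x = to_fract p / (q ^ a * poincare D (q\<^sup>2) ^ b)"
    "y = to_fract p' / (q ^ a' * poincare D (q\<^sup>2) ^ b')"
  define P where "P = (\<Sum>w\<in>weyl D. monom (1::int) (2 * len D w))"
  have "x + y = (to_fract p * (q ^ a' * poincare D (q\<^sup>2) ^ b') + to_fract p' * (q ^ a * poincare D (q\<^sup>2) ^ b))
      / (q ^ (a + a') * poincare D (q\<^sup>2) ^ (b + b'))"
    using poincare_nonzero unfolding xy by (simp add: field_simps power_add)
  also have "to_fract p * (q ^ a' * poincare D (q\<^sup>2) ^ b') + to_fract p' * (q ^ a * poincare D (q\<^sup>2) ^ b) =
      to_fract (p * (monom 1 a' * P ^ b') + p' * (monom 1 a * P ^ b))"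
    unfolding poincare_to_fract P_def[symmetric] by (simp add: q_power to_fract_power)
  finally show ?thesis
    using coeff_ringI by metis
qed

lemma coeff_ring_mult: "x \<in> coeff_ring D \<Longrightarrow> y \<in> coeff_ring D \<Longrightarrow> x * y \<in> coeff_ring D"
proof (elim coeff_ringE)
  fix p a b p' a' b'
  assume "x = to_fract p / (q ^ a * poincare D (q\<^sup>2) ^ b)"
    "y = to_fract p' / (q ^ a' * poincare D (q\<^sup>2) ^ b')"
  then have "x * y = to_fract (p * p') / (q ^ (a + a') * poincare D (q\<^sup>2) ^ (b + b'))"
    by (simp add: power_add)
  then show ?thesis
    using coeff_ringI by metis
qed

lemma to_fract_coeff_ring: "to_fract p \<in> coeff_ring D"
  using coeff_ringI[of p 0 0] by simp

lemma q_coeff_ring: "q \<in> coeff_ring D"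
  by (simp add: q_def to_fract_coeff_ring)

lemma inverse_q_coeff_ring: "inverse q \<in> coeff_ring D"
  using coeff_ringI[of 1 1 0] by (simp add: inverse_eq_divide)

lemma inverse_poincare_coeff_ring: "inverse (poincare D (q\<^sup>2)) \<in> coeff_ring D"
  using coeff_ringI[of 1 0 1] by (simp add: inverse_eq_divide)

lemma one_coeff_ring: "1 \<in> coeff_ring D"
  using to_fract_coeff_ring[of 1] by simp

lemma zero_coeff_ring: "0 \<in> coeff_ring D"
  using to_fract_coeff_ring[of 0] by simp

lemma coeff_ring_uminus: "x \<in> coeff_ring D \<Longrightarrow> - x \<in> coeff_ring D"
  using coeff_ring_mult[OF to_fract_coeff_ring[of "-1"]] by simp

lemma coeff_ring_diff: "x \<in> coeff_ring D \<Longrightarrow> y \<in> coeff_ring D \<Longrightarrow> x - y \<in> coeff_ring D"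
  using coeff_ring_add[OF _ coeff_ring_uminus] by fastforce

lemma coeff_ring_power: "x \<in> coeff_ring D \<Longrightarrow> x ^ n \<in> coeff_ring D"
  by (induction n) (auto intro: coeff_ring_mult one_coeff_ring)

lemma coeff_ring_sum: "(\<And>i. i \<in> A \<Longrightarrow> f i \<in> coeff_ring D) \<Longrightarrow> sum f A \<in> coeff_ring D"
  by (induction A rule: infinite_finite_induct) (auto intro: coeff_ring_add zero_coeff_ring)

lemmas coeff_ring_intros [intro] = coeff_ring_add coeff_ring_mult coeff_ring_uminus coeff_ring_diff
  coeff_ring_power coeff_ring_sum one_coeff_ring zero_coeff_ring q_coeff_ring inverse_q_coeff_ring
  inverse_poincare_coeff_ring

lemma inverse_poincare_inverse_coeff_ring: "inverse (poincare D ((inverse q)\<^sup>2)) \<in> coeff_ring D"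
proof -
  have "inverse (poincare D (inverse (q\<^sup>2))) = (q\<^sup>2) ^ card (pos D) * inverse (poincare D (q\<^sup>2))"
    by (simp add: poincare_inverse power_inverse)
  also have "\<dots> \<in> coeff_ring D"
    by blast
  finally show ?thesis
    by (simp add: power_inverse)
qed

text \<open>W splits into pairs of w and its product with the reflection, whose lengths differ by
  one; the sum on the right runs over the shorter members. At \<open>x = q\<^sup>2\<close> this
  exhibits \<open>1 + q\<^sup>2\<close> as a divisor of a unit.\<close>

lemma poincare_factor:
  fixes x :: ratfun
  assumes "\<alpha> \<in> simple_roots D"
  shows "poincare D x = (1 + x) * (\<Sum>w\<in>{w \<in> weyl D. len D w < len D (reflection D \<alpha> \<circ> w)}. x ^ len D w)"
proof -
  let ?s = "\<lambda>w. reflection D \<alpha> \<circ> w"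
  let ?U = "{w \<in> weyl D. len D w < len D (?s w)}"
  let ?V = "{w \<in> weyl D. len D (?s w) < len D w}"
  note r = simple_root[OF assms]
  have ss: "?s (?s w) = w" for w :: "'v \<Rightarrow> 'v"
    using r by (simp add: fun_eq_iff)
  have "weyl D = ?U \<union> ?V"
    using len_reflection[OF _ assms] by auto (metis lessI)
  then have "poincare D x = sum (\<lambda>w. x ^ len D w) (?U \<union> ?V)"
    unfolding poincare_def by simp
  also have "\<dots> = (\<Sum>w\<in>?U. x ^ len D w) + (\<Sum>w\<in>?V. x ^ len D w)"
    using finite_weyl by (intro sum.union_disjoint) auto
  also have "(\<Sum>w\<in>?V. x ^ len D w) = (\<Sum>w\<in>?U. x ^ len D (?s w))"
    by (rule sum.reindex_bij_witness[where i = ?s and j = ?s])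
      (use r ss in \<open>auto intro: weyl_reflection\<close>)
  also have "\<dots> = (\<Sum>w\<in>?U. x * x ^ len D w)"
    using len_reflection[OF _ assms] by (intro sum.cong) force+
  finally show ?thesis
    by (simp only: distrib_right sum_distrib_left sum.distrib mult_1_left)
qed

end

section \<open>The affine Hecke algebra\<close>

lemma const_simps:
  "const 0 = 0" "const 1 = 1" "const (a + b) = const a + const b" "const (a - b) = const a - const b"
  "const (- a) = - const a" "const (a * b) = const a * const b"
  by (simp_all add: const_def single_add single_diff single_uminus mult_single)

lemma poly_mapping_sum_single:
  "f = (\<Sum>k\<in>Poly_Mapping.keys f. Poly_Mapping.single k (Poly_Mapping.lookup f k))"
  by (rule poly_mapping_eqI)
    (auto simp: lookup_sum lookup_single when_def sum.delta in_keys_iff)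

lemma const_commute: "f * const c = const c * (f :: 'g word \<Rightarrow>\<^sub>0 'k::comm_ring_1)"
proof -
  have "(\<Sum>k\<in>Poly_Mapping.keys f. Poly_Mapping.single k (Poly_Mapping.lookup f k)) * const c =
      const c * (\<Sum>k\<in>Poly_Mapping.keys f. Poly_Mapping.single k (Poly_Mapping.lookup f k))"
    by (simp add: const_def sum_distrib_left sum_distrib_right mult_single mult.commute)
  then show ?thesis
    by (simp flip: poly_mapping_sum_single)
qed

lemma const_left_commute: "f * (const c * g) = const c * (f * g)"
  for f g :: "'g word \<Rightarrow>\<^sub>0 'k::comm_ring_1"
  by (metis const_commute mult.assoc)

lemma const_mult_const: "const a * (const b * f) = const (a * b) * f"
  by (simp add: const_simps mult.assoc)

text \<open>The defining sum runs over the support, which can shrink under addition; a common finite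
  superset makes additivity visible.\<close>

lemma from_group_algebra_superset:
  assumes "finite S" "Poly_Mapping.keys g \<subseteq> S"
  shows "from_group_algebra g = (\<Sum>\<nu>\<in>S. const (Poly_Mapping.lookup g \<nu>) * fX \<nu>)"
  unfolding from_group_algebra_def
  using assms by (intro sum.mono_neutral_left) (auto simp: in_keys_iff const_simps)

lemma from_group_algebra_add: "from_group_algebra (g + h) = from_group_algebra g + from_group_algebra h"
proof -
  let ?S = "Poly_Mapping.keys g \<union> Poly_Mapping.keys h"
  have "from_group_algebra (g + h) = (\<Sum>\<nu>\<in>?S. const (Poly_Mapping.lookup (g + h) \<nu>) * fX \<nu>)"
    using keys_add[of g h] by (intro from_group_algebra_superset) auto
  also have "\<dots> = from_group_algebra g + from_group_algebra h"
    by (simp add: from_group_algebra_superset[of ?S g] from_group_algebra_superset[of ?S h]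
        lookup_add const_simps distrib_right sum.distrib)
  finally show ?thesis .
qed

lemma from_group_algebra_sum_single:
  "from_group_algebra (\<Sum>i\<in>A. Poly_Mapping.single (f i) 1) = (\<Sum>i\<in>A. fX (f i))"
proof (induction A rule: infinite_finite_induct)
  case (insert i A)
  then show ?case
    by (simp add: from_group_algebra_add) (simp add: from_group_algebra_def const_simps)
qed (simp_all add: from_group_algebra_def)

context root_system
begin

section \<open>The free algebra and congruence modulo the ideal of relations\<close>

abbreviation hgens :: "'v hgen set" where
  "hgens \<equiv> GT ` simple_roots D \<union> GX ` weight_lattice D"

abbreviation hcarrier :: "('v hgen word \<Rightarrow>\<^sub>0 ratfun) set" where
  "hcarrier \<equiv> carrier (hecke_free D)"

lemma hcarrier_iff:
  "f \<in> hcarrier \<longleftrightarrow> (\<forall>w. Poly_Mapping.lookup f w \<in> coeff_ring D) \<and>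
    (\<forall>w\<in>Poly_Mapping.keys f. set (letters w) \<subseteq> hgens)"
  by (simp add: hecke_free_def free_algebra_def)

lemma hecke_free_simps [simp]:
  "f \<otimes>\<^bsub>hecke_free D\<^esub> g = f * g" "f \<oplus>\<^bsub>hecke_free D\<^esub> g = f + g" "\<one>\<^bsub>hecke_free D\<^esub> = 1" "\<zero>\<^bsub>hecke_free D\<^esub> = 0"
  by (simp_all add: hecke_free_def free_algebra_def)

lemma hcarrier_single:
  "c \<in> coeff_ring D \<Longrightarrow> set (letters w) \<subseteq> hgens \<Longrightarrow> Poly_Mapping.single w c \<in> hcarrier"
  by (auto simp: hcarrier_iff lookup_single when_def split: if_splits)

lemma hcarrier_zero: "0 \<in> hcarrier"
  by (auto simp: hcarrier_iff)

lemma hcarrier_add: "f \<in> hcarrier \<Longrightarrow> g \<in> hcarrier \<Longrightarrow> f + g \<in> hcarrier"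
  unfolding hcarrier_iff lookup_add using keys_add[of f g] coeff_ring_add by blast

lemma hcarrier_uminus: "f \<in> hcarrier \<Longrightarrow> - f \<in> hcarrier"
  by (simp add: hcarrier_iff in_keys_iff coeff_ring_uminus)

lemma hcarrier_diff: "f \<in> hcarrier \<Longrightarrow> g \<in> hcarrier \<Longrightarrow> f - g \<in> hcarrier"
  using hcarrier_add[OF _ hcarrier_uminus, of f g] by simp

lemma hcarrier_sum: "(\<And>i. i \<in> A \<Longrightarrow> f i \<in> hcarrier) \<Longrightarrow> sum f A \<in> hcarrier"
  by (induction A rule: infinite_finite_induct) (auto intro: hcarrier_add hcarrier_zero)

lemma hcarrier_mult: 
  assumes "f \<in> hcarrier" "g \<in> hcarrier"
  shows "f * g \<in> hcarrier"
proof -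
  have "(\<Sum>k\<in>Poly_Mapping.keys f. \<Sum>l\<in>Poly_Mapping.keys g.
      Poly_Mapping.single (k + l) (Poly_Mapping.lookup f k * Poly_Mapping.lookup g l)) \<in> hcarrier"
    using assms by (intro hcarrier_sum hcarrier_single) (auto simp: hcarrier_iff plus_word_def)
  also have "(\<Sum>k\<in>Poly_Mapping.keys f. \<Sum>l\<in>Poly_Mapping.keys g.
      Poly_Mapping.single (k + l) (Poly_Mapping.lookup f k * Poly_Mapping.lookup g l)) =
      (\<Sum>k\<in>Poly_Mapping.keys f. Poly_Mapping.single k (Poly_Mapping.lookup f k)) *
      (\<Sum>k\<in>Poly_Mapping.keys g. Poly_Mapping.single k (Poly_Mapping.lookup g k))"
    by (simp add: sum_product mult_single)
  finally show ?thesis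
    by (simp flip: poly_mapping_sum_single)
qed

lemma hcarrier_const: "c \<in> coeff_ring D \<Longrightarrow> const c \<in> hcarrier"
  unfolding const_def by (rule hcarrier_single) (auto simp: zero_word_def)

lemma hcarrier_one: "1 \<in> hcarrier"
  using hcarrier_const[of 1] by (auto simp: const_simps)

lemma hcarrier_fT: "\<alpha> \<in> simple_roots D \<Longrightarrow> fT \<alpha> \<in> hcarrier"
  unfolding gen_def by (rule hcarrier_single) auto

lemma hcarrier_fX: "\<nu> \<in> weight_lattice D \<Longrightarrow> fX \<nu> \<in> hcarrier"
  unfolding gen_def by (rule hcarrier_single) auto

lemma hcarrier_prod_list: "(\<And>f. f \<in> set fs \<Longrightarrow> f \<in> hcarrier) \<Longrightarrow> prod_list fs \<in> hcarrier"
  by (induction fs) (auto intro: hcarrier_mult hcarrier_one)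

lemma hcarrier_T_word: "set u \<subseteq> simple_roots D \<Longrightarrow> prod_list (map fT u) \<in> hcarrier"
  by (rule hcarrier_prod_list) (auto intro: hcarrier_fT)

lemmas hcarrier_intros [intro] = hcarrier_zero hcarrier_one hcarrier_add hcarrier_uminus hcarrier_diff
  hcarrier_sum hcarrier_mult hcarrier_const hcarrier_fT hcarrier_fX hcarrier_T_word

lemma ring_hecke_free: "ring (hecke_free D)"
proof (rule ringI)
  show "abelian_group (hecke_free D)"
    by (rule abelian_groupI) (auto simp: algebra_simps intro: bexI[of _ "- x" for x])
  show "monoid (hecke_free D)"
    by (rule monoidI) (auto simp: algebra_simps)
qed (auto simp: algebra_simps)

lemma weight_lattice_zero: "0 \<in> weight_lattice D"
  by (simp add: weight_lattice_def pairing_simps)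

lemma weight_lattice_add: "\<nu> \<in> weight_lattice D \<Longrightarrow> \<mu> \<in> weight_lattice D \<Longrightarrow> \<nu> + \<mu> \<in> weight_lattice D"
  by (simp add: weight_lattice_def pairing_simps)

lemma weight_lattice_sub_root:
  "\<nu> \<in> weight_lattice D \<Longrightarrow> \<alpha> \<in> roots D \<Longrightarrow> c \<in> \<int> \<Longrightarrow> \<nu> - c *\<^sub>R \<alpha> \<in> weight_lattice D"
  using integrality by (simp add: weight_lattice_def pairing_simps)

lemma weight_lattice_reflection:
  "\<nu> \<in> weight_lattice D \<Longrightarrow> \<alpha> \<in> roots D \<Longrightarrow> reflection D \<alpha> \<nu> \<in> weight_lattice D"
  unfolding reflection_def by (rule weight_lattice_sub_root) (auto simp: weight_lattice_def)

lemma weight_lattice_weyl: "w \<in> weyl D \<Longrightarrow> \<nu> \<in> weight_lattice D \<Longrightarrow> w \<nu> \<in> weight_lattice D"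
  by (induction rule: weyl.induct) (auto intro: weight_lattice_reflection)

text \<open>The facts on generated ideals apply to subsets of the carrier. For the cross relations
  this uses that g has its support in the weight lattice and its coefficients in
  \<open>coeff_ring D\<close>.\<close>

lemma hecke_rels_carrier: "braid_rels D \<union> quadratic_rels D \<union> lattice_rels D \<union> cross_rels D \<subseteq> hcarrier"
proof (intro Un_least)
  show "braid_rels D \<subseteq> hcarrier"
  proof
    fix f
    assume "f \<in> braid_rels D"
    then obtain \<alpha> \<beta> where *: "\<alpha> \<in> simple_roots D" "\<beta> \<in> simple_roots D"
      "f = prod_list (map fT (alternating \<alpha> \<beta> (braid_order D \<alpha> \<beta>)))
       - prod_list (map fT (alternating \<beta> \<alpha> (braid_order D \<alpha> \<beta>)))"
      unfolding braid_rels_def by blast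
    have "set (alternating \<alpha> \<beta> n) \<subseteq> simple_roots D" "set (alternating \<beta> \<alpha> n) \<subseteq> simple_roots D" for n
      using set_alternating[of \<alpha> \<beta> n] set_alternating[of \<beta> \<alpha> n] *(1,2) by auto
    then show "f \<in> hcarrier"
      unfolding *(3) by (intro hcarrier_diff hcarrier_T_word)
  qed
  show "quadratic_rels D \<subseteq> hcarrier"
    unfolding quadratic_rels_def by (auto intro!: hcarrier_intros coeff_ring_intros)
  show "lattice_rels D \<subseteq> hcarrier"
    unfolding lattice_rels_def
    by (auto intro!: hcarrier_diff hcarrier_mult hcarrier_fX hcarrier_one weight_lattice_add weight_lattice_zero)
  show "cross_rels D \<subseteq> hcarrier"
  proof
    fix f
    assume "f \<in> cross_rels D"
    then obtain \<nu> \<alpha> g where *: "\<nu> \<in> weight_lattice D" "\<alpha> \<in> simple_roots D" "g \<in> group_algebra D"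
      "f = fX \<nu> * fT \<alpha> - (fT \<alpha> * fX (reflection D \<alpha> \<nu>) + const (q - inverse q) * from_group_algebra g)"
      unfolding cross_rels_def by blast
    have "from_group_algebra g \<in> hcarrier"
      using *(3) unfolding from_group_algebra_def group_algebra_def
      by (auto intro!: hcarrier_sum hcarrier_mult hcarrier_const hcarrier_fX)
    then show "f \<in> hcarrier"
      unfolding *(4) using *(1,2) weight_lattice_reflection[OF *(1) simple_root[OF *(2)]]
      by (intro hcarrier_intros coeff_ring_intros)
  qed
qed

lemma ideal_hecke: "ideal (hecke_ideal D) (hecke_free D)"
  unfolding hecke_ideal_def
  by (rule ring.genideal_ideal[OF ring_hecke_free hecke_rels_carrier])

lemma hecke_rels_ideal: "braid_rels D \<union> quadratic_rels D \<union> lattice_rels D \<union> cross_rels D \<subseteq> hecke_ideal D"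
  unfolding hecke_ideal_def
  by (rule ring.genideal_self[OF ring_hecke_free hecke_rels_carrier])

lemma hecke_ideal_carrier: "f \<in> hecke_ideal D \<Longrightarrow> f \<in> hcarrier"
  using additive_subgroup.a_Hcarr[OF ideal.axioms(1)[OF ideal_hecke]] .

lemma hecke_ideal_zero: "0 \<in> hecke_ideal D"
  using additive_subgroup.zero_closed[OF ideal.axioms(1)[OF ideal_hecke]] by simp

lemma hecke_ideal_add: "f \<in> hecke_ideal D \<Longrightarrow> g \<in> hecke_ideal D \<Longrightarrow> f + g \<in> hecke_ideal D"
  using additive_subgroup.a_closed[OF ideal.axioms(1)[OF ideal_hecke]] by simp

lemma hecke_ideal_mult:
  "f \<in> hcarrier \<Longrightarrow> g \<in> hecke_ideal D \<Longrightarrow> f * g \<in> hecke_ideal D"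
  "f \<in> hcarrier \<Longrightarrow> g \<in> hecke_ideal D \<Longrightarrow> g * f \<in> hecke_ideal D"
  using ideal.I_l_closed[OF ideal_hecke] ideal.I_r_closed[OF ideal_hecke] by auto

lemma hecke_ideal_uminus: "f \<in> hecke_ideal D \<Longrightarrow> - f \<in> hecke_ideal D"
  using hecke_ideal_mult(1)[of "- 1" f] by auto

text \<open>Carrier membership is built in because the coset map is a homomorphism on the carrier
  only; in return the relation is reflexive only there.\<close>

definition heq :: "('v hgen word \<Rightarrow>\<^sub>0 ratfun) \<Rightarrow> ('v hgen word \<Rightarrow>\<^sub>0 ratfun) \<Rightarrow> bool"
    (infix "\<doteq>" 50) where
  "f \<doteq> g \<longleftrightarrow> f \<in> hcarrier \<and> g \<in> hcarrier \<and> f - g \<in> hecke_ideal D"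

lemma heq_carrier: "f \<doteq> g \<Longrightarrow> f \<in> hcarrier" "f \<doteq> g \<Longrightarrow> g \<in> hcarrier"
  by (auto simp: heq_def)

lemma heq_refl [intro]: "f \<in> hcarrier \<Longrightarrow> f \<doteq> f"
  by (simp add: heq_def hecke_ideal_zero)

lemma heq_sym: "f \<doteq> g \<Longrightarrow> g \<doteq> f"
  using hecke_ideal_uminus[of "f - g"] by (simp add: heq_def)

lemma heq_trans [trans]: "f \<doteq> g \<Longrightarrow> g \<doteq> h \<Longrightarrow> f \<doteq> h"
  using hecke_ideal_add[of "f - g" "g - h"] by (simp add: heq_def)

lemma heq_add: "f \<doteq> g \<Longrightarrow> f' \<doteq> g' \<Longrightarrow> f + f' \<doteq> g + g'"
  using hecke_ideal_add[of "f - g" "f' - g'"] by (auto simp: heq_def algebra_simps)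

lemma heq_uminus: "f \<doteq> g \<Longrightarrow> - f \<doteq> - g"
  using hecke_ideal_uminus[of "f - g"] by (auto simp: heq_def)

lemma heq_diff: "f \<doteq> g \<Longrightarrow> f' \<doteq> g' \<Longrightarrow> f - f' \<doteq> g - g'"
  using heq_add[OF _ heq_uminus, of f g f' g'] by simp

lemma heq_mult: "f \<doteq> g \<Longrightarrow> f' \<doteq> g' \<Longrightarrow> f * f' \<doteq> g * g'"
  using hecke_ideal_add[OF hecke_ideal_mult(1)[of f "f' - g'"] hecke_ideal_mult(2)[of g' "f - g"]]
  by (auto simp: heq_def algebra_simps)

lemma heq_const: "c \<in> coeff_ring D \<Longrightarrow> f \<doteq> g \<Longrightarrow> const c * f \<doteq> const c * g"
  by (rule heq_mult) auto

lemma heq_sum: "(\<And>i. i \<in> A \<Longrightarrow> f i \<doteq> g i) \<Longrightarrow> sum f A \<doteq> sum g A"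
  by (induction A rule: infinite_finite_induct) (auto intro: heq_add)

text \<open>Solves a congruence for one of its terms: moving terms across keeps the difference of
  the sides, which is an equation in a type class ring.\<close>

lemma heq_diff_iff: "f \<in> hcarrier \<Longrightarrow> g \<in> hcarrier \<Longrightarrow> f - g = h - k \<Longrightarrow> h \<doteq> k \<Longrightarrow> f \<doteq> g"
  by (simp add: heq_def)

lemma heq_braid:
  assumes "\<alpha> \<in> simple_roots D" "\<beta> \<in> simple_roots D" "\<alpha> \<noteq> \<beta>"
  shows "prod_list (map fT (alternating \<alpha> \<beta> (braid_order D \<alpha> \<beta>))) \<doteq>
    prod_list (map fT (alternating \<beta> \<alpha> (braid_order D \<alpha> \<beta>)))"
proof -
  have "prod_list (map fT (alternating \<alpha> \<beta> (braid_order D \<alpha> \<beta>))) -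
    prod_list (map fT (alternating \<beta> \<alpha> (braid_order D \<alpha> \<beta>))) \<in> braid_rels D"
    unfolding braid_rels_def using assms by blast
  moreover have "set (alternating \<alpha> \<beta> n) \<subseteq> simple_roots D" "set (alternating \<beta> \<alpha> n) \<subseteq> simple_roots D" for n
    using set_alternating[of \<alpha> \<beta> n] set_alternating[of \<beta> \<alpha> n] assms by auto
  ultimately show ?thesis
    using hecke_rels_ideal unfolding heq_def by blast
qed

lemma heq_quadratic:
  assumes "\<alpha> \<in> simple_roots D"
  shows "fT \<alpha> * fT \<alpha> \<doteq> const (q - inverse q) * fT \<alpha> + 1"
proof -
  have "fT \<alpha> * fT \<alpha> - (const (q - inverse q) * fT \<alpha> + 1) \<in> quadratic_rels D"
    unfolding quadratic_rels_def using assms by blast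
  then show ?thesis
    using hecke_rels_ideal assms unfolding heq_def by blast
qed

text \<open>
  \<open>(x\<^sup>\<nu> - x\<^bsup>s\<nu>\<^esup>) / (1 - x\<^sup>-\<^sup>\<alpha>)\<close> is a geometric sum with \<open>\<langle>\<nu>, \<alpha>\<^sup>\<or>\<rangle>\<close> terms.
\<close>

lemma heq_cross:
  assumes \<alpha>: "\<alpha> \<in> simple_roots D" and \<nu>: "\<nu> \<in> weight_lattice D" and n: "pairing D \<nu> \<alpha> = real n"
  shows "fX \<nu> * fT \<alpha> \<doteq> fT \<alpha> * fX (\<nu> - real n *\<^sub>R \<alpha>) +
    const (q - inverse q) * (\<Sum>j<n. fX (\<nu> - real j *\<^sub>R \<alpha>))"
proof -
  note r = simple_root[OF \<alpha>]
  define g :: "'v \<Rightarrow>\<^sub>0 ratfun" where "g = (\<Sum>j<n. Poly_Mapping.single (\<nu> - real j *\<^sub>R \<alpha>) 1)"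
  have lat: "\<nu> - real j *\<^sub>R \<alpha> \<in> weight_lattice D" for j
    using weight_lattice_sub_root[OF \<nu> r] by simp
  have refl: "reflection D \<alpha> \<nu> = \<nu> - real n *\<^sub>R \<alpha>"
    by (simp add: reflection_def n)
  have "Poly_Mapping.keys g \<subseteq> weight_lattice D"
    using keys_sum[of "\<lambda>j. Poly_Mapping.single (\<nu> - real j *\<^sub>R \<alpha>) (1::ratfun)" "{..<n}"] lat
    by (auto simp: g_def split: if_splits)
  then have "g \<in> group_algebra D"
    by (auto simp: group_algebra_def g_def lookup_sum lookup_single when_def
        intro!: coeff_ring_sum one_coeff_ring zero_coeff_ring)
  moreover have "g * (1 - Poly_Mapping.single (- \<alpha>) 1)
      = Poly_Mapping.single \<nu> 1 - Poly_Mapping.single (reflection D \<alpha> \<nu>) 1"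
  proof -
    have "\<nu> - real j *\<^sub>R \<alpha> + - \<alpha> = \<nu> - real (Suc j) *\<^sub>R \<alpha>" for j
      by (simp add: algebra_simps)
    then have "g * (1 - Poly_Mapping.single (- \<alpha>) 1) = (\<Sum>j<n. Poly_Mapping.single (\<nu> - real j *\<^sub>R \<alpha>) 1 -
        Poly_Mapping.single (\<nu> - real (Suc j) *\<^sub>R \<alpha>) 1)"
      by (simp only: g_def right_diff_distrib sum_distrib_right mult_single mult_1_right sum_subtractf)
    also have "\<dots> = Poly_Mapping.single \<nu> 1 - Poly_Mapping.single (reflection D \<alpha> \<nu>) 1"
      unfolding refl
      by (subst sum_lessThan_telescope'[of "\<lambda>j. Poly_Mapping.single (\<nu> - real j *\<^sub>R \<alpha>) 1"]) simp
    finally show ?thesis .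
  qed
  ultimately have "fX \<nu> * fT \<alpha> - (fT \<alpha> * fX (reflection D \<alpha> \<nu>) +
      const (q - inverse q) * from_group_algebra g) \<in> cross_rels D"
    unfolding cross_rels_def using \<alpha> \<nu> by blast
  then have "fX \<nu> * fT \<alpha> - (fT \<alpha> * fX (\<nu> - real n *\<^sub>R \<alpha>) +
      const (q - inverse q) * (\<Sum>j<n. fX (\<nu> - real j *\<^sub>R \<alpha>))) \<in> hecke_ideal D"
    using hecke_rels_ideal unfolding refl g_def from_group_algebra_sum_single by blast
  then show ?thesis
    using \<alpha> \<nu> lat unfolding heq_def by blast
qed

subsection \<open>Sums of the \<open>T\<^sub>w\<close>\<close>

text \<open>A lift of \<open>hTw D w\<close>, using the same choice of reduced word so that its
  class is \<open>hTw D w\<close> without appeal to independence of the word.\<close>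

definition T_elt :: "('v \<Rightarrow> 'v) \<Rightarrow> 'v hgen word \<Rightarrow>\<^sub>0 ratfun" where
  "T_elt w = prod_list (map fT (SOME u. reduced_word D w u))"

lemma T_word_eq:
  assumes "w \<in> weyl D" "reduced_word D w u" "reduced_word D w v"
  shows "prod_list (map fT u) \<doteq> prod_list (map fT v)"
proof -
  \<comment> \<open>Carrier membership is left out here, since \<open>matsumoto\<close> asks for an
    equivalence on all words, including those with letters that are not simple roots.\<close>
  define R where "R u v \<longleftrightarrow> prod_list (map fT u) - prod_list (map fT v) \<in> hecke_ideal D" for u v :: "'v list"
  have "R u v"
  proof (rule matsumoto[OF _ _ _ assms])
    show "equivp R"
    proof (rule equivpI)
      show "reflp R"
        by (rule reflpI) (simp add: R_def hecke_ideal_zero)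
      show "symp R"
        unfolding R_def by (rule sympI) (metis hecke_ideal_uminus minus_diff_eq)
      show "transp R"
      proof (rule transpI)
        fix u v w
        assume "R u v" "R v w"
        from hecke_ideal_add[OF this[unfolded R_def]] show "R u w"
          by (simp add: R_def)
      qed
    qed
    show "R (a # u) (a # v)" if "a \<in> simple_roots D" "R u v" for a u v
      using hecke_ideal_mult(1)[OF hcarrier_fT[OF that(1)]] that(2)
      by (simp add: R_def flip: right_diff_distrib)
    show "R (alternating \<alpha> \<beta> (braid_order D \<alpha> \<beta>) @ x) (alternating \<beta> \<alpha> (braid_order D \<alpha> \<beta>) @ x)"
      if "\<alpha> \<in> simple_roots D" "\<beta> \<in> simple_roots D" "\<alpha> \<noteq> \<beta>" "set x \<subseteq> simple_roots D" for \<alpha> \<beta> x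
      using hecke_ideal_mult(2)[OF hcarrier_T_word[OF that(4)]] heq_braid[OF that(1-3)]
      by (simp add: R_def heq_def flip: left_diff_distrib)
  qed
  with assms show ?thesis
    by (auto simp: heq_def R_def reduced_word_def)
qed

lemma T_elt_word:
  assumes "w \<in> weyl D" "reduced_word D w u"
  shows "T_elt w \<doteq> prod_list (map fT u)"
  unfolding T_elt_def by (rule T_word_eq[OF assms(1) someI assms(2)]) (rule assms(2))

lemma T_elt_carrier: "w \<in> weyl D \<Longrightarrow> T_elt w \<in> hcarrier"
  using ex_reduced_word T_elt_word heq_carrier by blast

text \<open>If the product is longer, prefixing \<alpha> keeps a reduced word of w reduced.
  Otherwise w has a reduced word starting with \<alpha>, and the quadratic relation supplies the
  extra term.\<close>

lemma T_elt_mult_left: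
  assumes w: "w \<in> weyl D" and \<alpha>: "\<alpha> \<in> simple_roots D"
  shows "fT \<alpha> * T_elt w \<doteq> T_elt (reflection D \<alpha> \<circ> w) +
    const (if len D (reflection D \<alpha> \<circ> w) < len D w then q - inverse q else 0) * T_elt w"
proof -
  let ?s = "reflection D \<alpha>"
  note r = simple_root[OF \<alpha>]
  have sw: "?s \<circ> w \<in> weyl D"
    using w r by (auto intro: weyl_reflection)
  consider "len D (?s \<circ> w) = Suc (len D w)" | "len D w = Suc (len D (?s \<circ> w))"
    using len_reflection[OF w \<alpha>] by blast
  then show ?thesis
  proof cases
    case 1
    obtain u where u: "reduced_word D w u"
      using ex_reduced_word[OF w] by blast
    have "fT \<alpha> * T_elt w \<doteq> fT \<alpha> * prod_list (map fT u)"
      by (intro heq_mult heq_refl T_elt_word w u hcarrier_fT \<alpha>)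
    also have "fT \<alpha> * prod_list (map fT u) = prod_list (map fT (\<alpha> # u))"
      by simp
    also have "\<dots> \<doteq> T_elt (?s \<circ> w)"
      using u \<alpha> 1 by (intro heq_sym[OF T_elt_word] sw) (auto simp: reduced_word_def)
    finally show ?thesis
      using 1 by (simp add: const_simps)
  next
    case 2
    obtain u where u: "reduced_word D (?s \<circ> w) u"
      using ex_reduced_word[OF sw] by blast
    let ?U = "prod_list (map fT u)"
    have "reduced_word D w (\<alpha> # u)"
      using u \<alpha> 2 r by (auto simp: reduced_word_def fun_eq_iff)
    from T_elt_word[OF w this] have Tw: "T_elt w \<doteq> fT \<alpha> * ?U"
      by simp
    have U: "?U \<in> hcarrier"
      using u by (auto simp: reduced_word_def)
    have "fT \<alpha> * T_elt w \<doteq> fT \<alpha> * (fT \<alpha> * ?U)"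
      by (intro heq_mult heq_refl Tw hcarrier_fT \<alpha>)
    also have "fT \<alpha> * (fT \<alpha> * ?U) = (fT \<alpha> * fT \<alpha>) * ?U"
      by (simp add: mult.assoc)
    also have "\<dots> \<doteq> (const (q - inverse q) * fT \<alpha> + 1) * ?U"
      by (intro heq_mult heq_quadratic heq_refl \<alpha> U)
    also have "\<dots> = ?U + const (q - inverse q) * (fT \<alpha> * ?U)"
      by (simp add: algebra_simps)
    also have "\<dots> \<doteq> T_elt (?s \<circ> w) + const (q - inverse q) * T_elt w"
      by (intro heq_add heq_const heq_sym[OF Tw] heq_sym[OF T_elt_word] sw u) blast
    finally show ?thesis
      using 2 by simp
  qed
qed

lemma T_elt_mult_right:
  assumes w: "w \<in> weyl D" and \<alpha>: "\<alpha> \<in> simple_roots D"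
  shows "T_elt w * fT \<alpha> \<doteq> T_elt (w \<circ> reflection D \<alpha>) +
    const (if len D (w \<circ> reflection D \<alpha>) < len D w then q - inverse q else 0) * T_elt w"
proof -
  let ?s = "reflection D \<alpha>"
  note r = simple_root[OF \<alpha>]
  have sw: "w \<circ> ?s \<in> weyl D"
    using w r by (auto intro: weyl_comp weyl_refl)
  consider "len D (w \<circ> ?s) = Suc (len D w)" | "len D w = Suc (len D (w \<circ> ?s))"
    using len_reflection_right[OF w \<alpha>] by blast
  then show ?thesis
  proof cases
    case 1
    obtain u where u: "reduced_word D w u"
      using ex_reduced_word[OF w] by blast
    have "T_elt w * fT \<alpha> \<doteq> prod_list (map fT u) * fT \<alpha>"
      by (intro heq_mult heq_refl T_elt_word w u hcarrier_fT \<alpha>)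
    also have "prod_list (map fT u) * fT \<alpha> = prod_list (map fT (u @ [\<alpha>]))"
      by simp
    also have "\<dots> \<doteq> T_elt (w \<circ> ?s)"
      using u \<alpha> 1 by (intro heq_sym[OF T_elt_word] sw) (auto simp: reduced_word_def word_prod_append)
    finally show ?thesis
      using 1 by (simp add: const_simps)
  next
    case 2
    obtain u where u: "reduced_word D (w \<circ> ?s) u"
      using ex_reduced_word[OF sw] by blast
    let ?U = "prod_list (map fT u)"
    have "reduced_word D w (u @ [\<alpha>])"
      using u \<alpha> 2 r by (auto simp: reduced_word_def word_prod_append fun_eq_iff)
    from T_elt_word[OF w this] have Tw: "T_elt w \<doteq> ?U * fT \<alpha>"
      by simp
    have U: "?U \<in> hcarrier"
      using u by (auto simp: reduced_word_def)
    have "T_elt w * fT \<alpha> \<doteq> (?U * fT \<alpha>) * fT \<alpha>"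
      by (intro heq_mult heq_refl Tw hcarrier_fT \<alpha>)
    also have "(?U * fT \<alpha>) * fT \<alpha> = ?U * (fT \<alpha> * fT \<alpha>)"
      by (simp add: mult.assoc)
    also have "\<dots> \<doteq> ?U * (const (q - inverse q) * fT \<alpha> + 1)"
      by (intro heq_mult heq_quadratic heq_refl \<alpha> U)
    also have "\<dots> = ?U + const (q - inverse q) * (?U * fT \<alpha>)"
      by (simp add: distrib_left const_left_commute)
    also have "\<dots> \<doteq> T_elt (w \<circ> ?s) + const (q - inverse q) * T_elt w"
      by (intro heq_add heq_const heq_sym[OF Tw] heq_sym[OF T_elt_word] sw u) blast
    finally show ?thesis
      using 2 by simp
  qed
qed

text \<open>
  The unnormalised idempotents are the cases \<open>c = q\<close> and \<open>c = - q\<^sup>-\<^sup>1\<close>, the two roots of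
  \<open>c - c\<^sup>-\<^sup>1 = q - q\<^sup>-\<^sup>1\<close>.
\<close>

definition T_sum :: "ratfun \<Rightarrow> 'v hgen word \<Rightarrow>\<^sub>0 ratfun" where
  "T_sum c = (\<Sum>w\<in>weyl D. const (c ^ len D w) * T_elt w)"

lemma T_sum_carrier: "c \<in> coeff_ring D \<Longrightarrow> T_sum c \<in> hcarrier"
  unfolding T_sum_def using T_elt_carrier by blast

text \<open>Here \<phi> is left or right multiplication by a simple reflection. After reindexing,
  the coefficient at w of length l is \<open>c ^ (l + 1)\<close> when \<open>\<phi> w\<close> is
  longer, and \<open>c ^ (l - 1) + c ^ l * (c - inverse c)\<close> when it is shorter, which is
  again \<open>c ^ (l + 1)\<close>.\<close>

lemma T_sum_step:
  assumes c: "c \<noteq> 0" "c - inverse c = q - inverse q"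
    and bij: "bij_betw \<phi> (weyl D) (weyl D)" and inv: "\<And>w. \<phi> (\<phi> w) = w"
    and len: "\<And>w. w \<in> weyl D \<Longrightarrow> len D (\<phi> w) = Suc (len D w) \<or> len D w = Suc (len D (\<phi> w))"
  shows "(\<Sum>w\<in>weyl D. const (c ^ len D w) *
      (T_elt (\<phi> w) + const (if len D (\<phi> w) < len D w then q - inverse q else 0) * T_elt w)) =
    const c * T_sum c"
proof -
  define e where "e w = (if len D (\<phi> w) < len D w then q - inverse q else 0)" for w
  \<comment> \<open>Writing w as \<open>\<phi> (\<phi> w)\<close> makes the first sum a function of
    \<open>\<phi> w\<close>, ready for reindexing.\<close>
  have "(\<Sum>w\<in>weyl D. const (c ^ len D w) * (T_elt (\<phi> w) + const (e w) * T_elt w)) =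
      (\<Sum>w\<in>weyl D. const (c ^ len D (\<phi> (\<phi> w))) * T_elt (\<phi> w)) +
      (\<Sum>w\<in>weyl D. const (c ^ len D w * e w) * T_elt w)"
    by (simp add: inv distrib_left sum.distrib const_mult_const)
  also have "(\<Sum>w\<in>weyl D. const (c ^ len D (\<phi> (\<phi> w))) * T_elt (\<phi> w)) =
      (\<Sum>w\<in>weyl D. const (c ^ len D (\<phi> w)) * T_elt w)"
    by (rule sum.reindex_bij_betw[OF bij])
  also have "\<dots> + (\<Sum>w\<in>weyl D. const (c ^ len D w * e w) * T_elt w) =
      (\<Sum>w\<in>weyl D. const (c ^ len D (\<phi> w) + c ^ len D w * e w) * T_elt w)"
    by (simp add: const_simps distrib_right sum.distrib)
  also have "\<dots> = (\<Sum>w\<in>weyl D. const (c * c ^ len D w) * T_elt w)"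
  proof (rule sum.cong[OF refl])
    fix w
    assume "w \<in> weyl D"
    then have "c ^ len D (\<phi> w) + c ^ len D w * e w = c * c ^ len D w"
      using len[of w] c(1) unfolding e_def c(2)[symmetric] by (auto simp: field_simps)
    then show "const (c ^ len D (\<phi> w) + c ^ len D w * e w) * T_elt w = const (c * c ^ len D w) * T_elt w"
      by simp
  qed
  finally show ?thesis
    by (simp add: e_def T_sum_def sum_distrib_left const_mult_const)
qed

lemma T_sum_left:
  assumes "\<alpha> \<in> simple_roots D" "c \<in> coeff_ring D" "c \<noteq> 0" "c - inverse c = q - inverse q"
  shows "fT \<alpha> * T_sum c \<doteq> const c * T_sum c"
proof -
  note r = simple_root[OF assms(1)]
  have "fT \<alpha> * T_sum c = (\<Sum>w\<in>weyl D. const (c ^ len D w) * (fT \<alpha> * T_elt w))"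
    by (simp add: T_sum_def sum_distrib_left const_left_commute)
  also have "\<dots> \<doteq> (\<Sum>w\<in>weyl D. const (c ^ len D w) * (T_elt (reflection D \<alpha> \<circ> w) +
      const (if len D (reflection D \<alpha> \<circ> w) < len D w then q - inverse q else 0) * T_elt w))"
    using assms by (intro heq_sum heq_const T_elt_mult_left) auto
  also have "\<dots> = const c * T_sum c"
    by (rule T_sum_step[OF assms(3,4) bij_betw_reflection_left[OF r] _ len_reflection[OF _ assms(1)]])
      (use r in \<open>auto simp: fun_eq_iff\<close>)
  finally show ?thesis .
qed

lemma T_sum_right:
  assumes "\<alpha> \<in> simple_roots D" "c \<in> coeff_ring D" "c \<noteq> 0" "c - inverse c = q - inverse q"
  shows "T_sum c * fT \<alpha> \<doteq> const c * T_sum c"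
proof -
  note r = simple_root[OF assms(1)]
  have "T_sum c * fT \<alpha> = (\<Sum>w\<in>weyl D. const (c ^ len D w) * (T_elt w * fT \<alpha>))"
    by (simp add: T_sum_def sum_distrib_right mult.assoc)
  also have "\<dots> \<doteq> (\<Sum>w\<in>weyl D. const (c ^ len D w) * (T_elt (w \<circ> reflection D \<alpha>) +
      const (if len D (w \<circ> reflection D \<alpha>) < len D w then q - inverse q else 0) * T_elt w))"
    using assms by (intro heq_sum heq_const T_elt_mult_right) auto
  also have "\<dots> = const c * T_sum c"
    by (rule T_sum_step[OF assms(3,4) bij_betw_reflection_right[OF r] _ len_reflection_right[OF _ assms(1)]])
      (use r in \<open>auto simp: fun_eq_iff\<close>)
  finally show ?thesis .
qed

subsection \<open>Straightening\<close>

text \<open>Evaluates \<open>e * fX \<nu> * fT \<alpha> * f\<close> in two ways: f absorbs the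
  middle generator with factor z, or the cross relation moves it left, where e absorbs it with
  factor y. M is the case \<open>y = z = q\<close>; A is the case \<open>y = inverse (- q)\<close>,
  \<open>z = q\<close>.\<close>

lemma heq_cross_sandwich:
  assumes \<alpha>: "\<alpha> \<in> simple_roots D" and \<nu>: "\<nu> \<in> weight_lattice D" and n: "pairing D \<nu> \<alpha> = real n"
    and e: "e \<in> hcarrier" "e * fT \<alpha> \<doteq> const y * e" "y \<in> coeff_ring D"
    and f: "f \<in> hcarrier" "fT \<alpha> * f \<doteq> const z * f"
  shows "const z * (e * fX \<nu> * f) \<doteq> const y * (e * fX (\<nu> - real n *\<^sub>R \<alpha>) * f) +
    const (q - inverse q) * (\<Sum>j<n. e * fX (\<nu> - real j *\<^sub>R \<alpha>) * f)"
proof -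
  let ?x = "\<lambda>j::nat. fX (\<nu> - real j *\<^sub>R \<alpha>)"
  have x: "?x j \<in> hcarrier" for j
    using weight_lattice_sub_root[OF \<nu> simple_root[OF \<alpha>]] by (intro hcarrier_fX) simp
  have eX: "e * fX \<nu> \<in> hcarrier"
    using e(1) \<nu> by auto
  have "const z * (e * fX \<nu> * f) = e * fX \<nu> * (const z * f)"
    by (rule const_left_commute[symmetric])
  also have "\<dots> \<doteq> e * fX \<nu> * (fT \<alpha> * f)"
    by (rule heq_mult[OF heq_refl[OF eX] heq_sym[OF f(2)]])
  also have "\<dots> = e * (fX \<nu> * fT \<alpha>) * f"
    by (simp add: mult.assoc)
  also have "\<dots> \<doteq> e * (fT \<alpha> * ?x n + const (q - inverse q) * (\<Sum>j<n. ?x j)) * f"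
    by (intro heq_mult heq_refl e(1) f(1) heq_cross \<alpha> \<nu> n)
  also have "\<dots> = (e * fT \<alpha>) * (?x n * f) + const (q - inverse q) * (\<Sum>j<n. e * ?x j * f)"
    by (simp add: distrib_left distrib_right mult.assoc const_left_commute sum_distrib_left
        sum_distrib_right)
  also have "\<dots> \<doteq> (const y * e) * (?x n * f) + const (q - inverse q) * (\<Sum>j<n. e * ?x j * f)"
    by (intro heq_add heq_mult[OF e(2)] heq_refl hcarrier_mult hcarrier_sum hcarrier_const
        coeff_ring_diff q_coeff_ring inverse_q_coeff_ring e(1) f(1) x)
  finally show ?thesis
    by (simp add: mult.assoc)
qed

text \<open>The right-hand side of the formula for M, with \<open>b j\<close> for the element at
  \<open>\<mu> - j \<alpha>\<close>. For \<open>d > 0\<close> none of the natural subtractions is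
  truncated.\<close>

definition straightening :: "ratfun \<Rightarrow> nat \<Rightarrow> (nat \<Rightarrow> 'v hgen word \<Rightarrow>\<^sub>0 ratfun) \<Rightarrow> 'v hgen word \<Rightarrow>\<^sub>0 ratfun" where
  "straightening t d b = const t * b 0 + (\<Sum>j\<in>{1..(d - 1) div 2}. const ((t ^ 2 - 1) * t ^ (j - 1)) * b j) +
    (if even d then const ((t - 1) * t ^ (d div 2 - 1)) * b (d div 2) else 0)"

text \<open>The shifted sequence is the one belonging to \<open>\<mu> - \<alpha>\<close>. Its
  leading term contributes \<open>t * t\<close> at \<open>b 1\<close>, and subtracting
  \<open>b 1\<close> gives the coefficient \<open>t ^ 2 - 1\<close>; the other coefficients are
  multiplied by t.\<close>

lemma straightening_Suc_Suc:
  assumes "0 < d"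
  shows "straightening t (Suc (Suc d)) b = const t * b 0 - b 1 + const t * straightening t d (\<lambda>j. b (Suc j))"
proof -
  define m where "m = (d - 1) div 2"
  have m: "(Suc (Suc d) - 1) div 2 = Suc m"
    using assms by (simp add: m_def)
  have "(\<Sum>j\<in>{1..Suc m}. const ((t ^ 2 - 1) * t ^ (j - 1)) * b j) =
      const (t ^ 2 - 1) * b 1 + (\<Sum>j\<in>{1..m}. const ((t ^ 2 - 1) * t ^ j) * b (Suc j))"
    by (subst sum.atLeast_Suc_atMost) (simp_all add: sum.shift_bounds_cl_Suc_ivl del: sum.cl_ivl_Suc)
  also have "(\<Sum>j\<in>{1..m}. const ((t ^ 2 - 1) * t ^ j) * b (Suc j)) =
      const t * (\<Sum>j\<in>{1..m}. const ((t ^ 2 - 1) * t ^ (j - 1)) * b (Suc j))"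
    unfolding sum_distrib_left
  proof (rule sum.cong[OF refl])
    fix j
    assume "j \<in> {1..m}"
    then obtain i where "j = Suc i"
      by (cases j) auto
    then show "const ((t ^ 2 - 1) * t ^ j) * b (Suc j) = const t * (const ((t ^ 2 - 1) * t ^ (j - 1)) * b (Suc j))"
      by (simp add: const_mult_const algebra_simps)
  qed
  finally have sum: "(\<Sum>j\<in>{1..Suc m}. const ((t ^ 2 - 1) * t ^ (j - 1)) * b j) =
      const (t ^ 2 - 1) * b 1 + const t * (\<Sum>j\<in>{1..m}. const ((t ^ 2 - 1) * t ^ (j - 1)) * b (Suc j))" .
  have even: "const ((t - 1) * t ^ (Suc (Suc d) div 2 - 1)) * b (Suc (Suc d) div 2) =
      const t * (const ((t - 1) * t ^ (d div 2 - 1)) * b (Suc (d div 2)))" if "even d"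
  proof -
    \<comment> \<open>Positivity of d keeps the exponent \<open>d div 2 - 1\<close> from being
      truncated.\<close>
    from that assms obtain k where "d div 2 = Suc k"
      by (metis One_nat_def dvd_div_eq_0_iff gr0_implies_Suc gr0I not_less_zero)
    then show ?thesis
      by (simp add: const_mult_const algebra_simps)
  qed
  have t2: "const (t ^ 2 - 1) * b 1 = const t * (const t * b 1) - b 1"
    by (simp add: const_simps power2_eq_square left_diff_distrib mult.assoc)
  have if_even: "(if even (Suc (Suc d)) then const ((t - 1) * t ^ (Suc (Suc d) div 2 - 1)) * b (Suc (Suc d) div 2) else 0) =
      const t * (if even d then const ((t - 1) * t ^ (d div 2 - 1)) * b (Suc (d div 2)) else 0)"
    using even by (cases "even d") (simp_all only: even_Suc not_not if_True if_False mult_zero_right)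
  have ring: "k * x + (k * (k * y) - y + k * s) + k * z = k * x - y + k * (k * y + s + z)"
    for k x y z s :: "'v hgen word \<Rightarrow>\<^sub>0 ratfun"
    by (simp add: algebra_simps)
  show ?thesis
    by (simp only: straightening_def m sum t2 m_def[symmetric] if_even ring) (simp only: One_nat_def)
qed

text \<open>The relations are assumed for all k up to half of d because the induction passes to the
  shifted sequence and d - 2, where the relation for k is the old one for \<open>Suc k\<close>. Both
  1 and 2 are base cases: \<open>straightening t 0 b\<close> is \<open>(2 t - 1) b 0\<close>, so d =
  2 cannot be reached from d = 0.\<close>

lemma heq_straightening:
  assumes t: "t \<in> coeff_ring D" and "\<And>j. b j \<in> hcarrier" and "0 < d"
    and "\<And>k. 2 * k \<le> d \<Longrightarrow> b k \<doteq> b (d - k) + const (1 - t) * (\<Sum>j<d - 2 * k. b (k + j))"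
  shows "b d \<doteq> straightening t d b"
  using assms(2-)
proof (induction d arbitrary: b rule: less_induct)
  case (less d)
  note b = less.prems(1)
  note rel = less.prems(3)
  consider "d = 1" | "d = 2" | e where "0 < e" "d = Suc (Suc e)"
    using less.prems(2) by (metis One_nat_def Suc_1 gr0_conv_Suc not_gr0)
  then show ?case
  proof cases
    case 1
    from rel[of 0] 1 have *: "b 0 \<doteq> b 1 + const (1 - t) * b 0"
      by simp
    have "b 1 \<doteq> const t * b 0"
      by (rule heq_diff_iff[OF b _ _ heq_sym[OF *]])
        (use t b in \<open>auto simp: const_simps algebra_simps\<close>)
    then show ?thesis
      by (simp add: straightening_def 1)
  next
    case 2
    from rel[of 0] 2 have *: "b 0 \<doteq> b 2 + const (1 - t) * (b 0 + b 1)"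
      by (simp add: numeral_2_eq_2)
    have "b 2 \<doteq> const t * b 0 + const (t - 1) * b 1"
      by (rule heq_diff_iff[OF b _ _ heq_sym[OF *]])
        (use t b in \<open>auto simp: const_simps algebra_simps intro!: hcarrier_intros\<close>)
    then show ?thesis
      by (simp add: straightening_def 2)
  next
    case (3 e)
    have IH: "b (Suc e) \<doteq> straightening t e (\<lambda>j. b (Suc j))"
    proof (rule less.IH)
      show "e < d" "0 < e" "\<And>j. b (Suc j) \<in> hcarrier"
        using 3 b by auto
      fix k
      assume k: "2 * k \<le> e"
      then show "b (Suc k) \<doteq> b (Suc (e - k)) + const (1 - t) * (\<Sum>j<e - 2 * k. b (Suc (k + j)))"
        using rel[of "Suc k"] 3 by (simp add: Suc_diff_le)
    qed
    define S where "S = (\<Sum>j<e. b (Suc j))"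
    have "(\<Sum>j<d. b j) = b 0 + S + b (Suc e)"
      by (simp add: 3 S_def sum.lessThan_Suc_shift[of b] del: sum.lessThan_Suc)
        (simp add: sum.lessThan_Suc)
    with rel[of 0] have 1: "b 0 \<doteq> b d + const (1 - t) * (b 0 + S + b (Suc e))"
      by simp
    from rel[of 1] 3 have 2: "b 1 \<doteq> b (Suc e) + const (1 - t) * S"
      by (simp add: S_def)
    \<comment> \<open>In the difference of the two relations S cancels:
      \<open>b 0 - b 1 = b d - b (Suc e) + (1 - t) (b 0 + b (Suc e))\<close>, where
      \<open>Suc e\<close> is d - 1.\<close>
    have "b d \<doteq> const t * b 0 - b 1 + const t * b (Suc e)"
      by (rule heq_diff_iff[OF b _ _ heq_sym[OF heq_diff[OF 1 2]]])
        (use t b in \<open>auto simp: const_simps algebra_simps\<close>)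
    also have "\<dots> \<doteq> const t * b 0 - b 1 + const t * straightening t e (\<lambda>j. b (Suc j))"
      using t b by (intro heq_add heq_const heq_refl IH hcarrier_diff hcarrier_mult hcarrier_const)
    finally show ?thesis
      by (simp add: straightening_Suc_Suc[OF 3(1)] 3(2))
  qed
qed

text \<open>The same descent from d to d - 2, now with the relations multiplied by q. The torsion
  hypothesis enters at d = 0, where the relation reads \<open>q^2 b 0 = - b 0\<close>.\<close>

lemma heq_antisymmetric:
  fixes b :: "nat \<Rightarrow> 'v hgen word \<Rightarrow>\<^sub>0 ratfun"
  assumes torsion: "\<And>f. f \<in> hcarrier \<Longrightarrow> const (1 + q\<^sup>2) * f \<doteq> 0 \<Longrightarrow> f \<doteq> 0"
    and "\<And>j. b j \<in> hcarrier"
    and "\<And>k. 2 * k \<le> d \<Longrightarrow> const (q\<^sup>2) * b k \<doteq> - b (d - k) + const (q\<^sup>2 - 1) * (\<Sum>j<d - 2 * k. b (k + j))"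
  shows "b d \<doteq> - b 0"
  using assms(2-)
proof (induction d arbitrary: b rule: less_induct)
  case (less d)
  note b = less.prems(1)
  note rel = less.prems(2)
  have q2: "const (q\<^sup>2) \<in> hcarrier"
    by blast
  consider "d = 0" | "d = 1" | e where "d = Suc (Suc e)"
    by (metis One_nat_def not0_implies_Suc)
  then show ?case
  proof cases
    case 1
    have "const (1 + q\<^sup>2) * b 0 \<doteq> 0"
      by (rule heq_diff_iff[OF _ _ _ rel[of 0]])
        (use b 1 in \<open>auto simp: const_simps(2-5) algebra_simps intro!: hcarrier_intros coeff_ring_intros\<close>)
    then have "b 0 \<doteq> 0"
      by (rule torsion[OF b])
    then have "b 0 \<doteq> - 0" "- b 0 \<doteq> - 0"
      using heq_uminus by fastforce+
    then show ?thesis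
      unfolding 1 using heq_trans heq_sym by blast
  next
    case 2
    show ?thesis
      by (rule heq_diff_iff[OF b _ _ rel[of 0]])
        (use b 2 in \<open>auto simp: const_simps(2-5) algebra_simps intro!: hcarrier_uminus\<close>)
  next
    case (3 e)
    have IH: "b (Suc e) \<doteq> - b 1"
      unfolding One_nat_def
    proof (rule less.IH)
      show "e < d" "\<And>j. b (Suc j) \<in> hcarrier"
        using 3 b by auto
      fix k
      assume k: "2 * k \<le> e"
      then show "const (q\<^sup>2) * b (Suc k) \<doteq> - b (Suc (e - k)) + const (q\<^sup>2 - 1) * (\<Sum>j<e - 2 * k. b (Suc (k + j)))"
        using rel[of "Suc k"] 3 by (simp add: Suc_diff_le)
    qed
    define S where "S = (\<Sum>j<e. b (Suc j))"
    have "(\<Sum>j<d. b j) = b 0 + S + b (Suc e)"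
      by (simp add: 3 S_def sum.lessThan_Suc_shift[of b] del: sum.lessThan_Suc)
        (simp add: sum.lessThan_Suc)
    with rel[of 0] have 1: "const (q\<^sup>2) * b 0 \<doteq> - b d + const (q\<^sup>2 - 1) * (b 0 + S + b (Suc e))"
      by simp
    from rel[of 1] 3 have 2: "const (q\<^sup>2) * b 1 \<doteq> - b (Suc e) + const (q\<^sup>2 - 1) * S"
      by (simp add: S_def)
    \<comment> \<open>S cancels as before, and the induction hypothesis for the inner segment makes
      the bracket vanish.\<close>
    have "b d \<doteq> - b 0 + const (q\<^sup>2) * (b 1 + b (Suc e))"
      by (rule heq_diff_iff[OF b _ _ heq_diff[OF 1 2]])
        (use b q2 in \<open>auto simp: const_simps(2-5) algebra_simps intro!: hcarrier_intros\<close>)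
    also have "\<dots> \<doteq> - b 0 + const (q\<^sup>2) * (b 1 + - b 1)"
      using b by (intro heq_add heq_const heq_refl IH hcarrier_uminus coeff_ring_power q_coeff_ring)
    finally show ?thesis
      by simp
  qed
qed

lemma heq_torsion_free:
  assumes \<alpha>: "\<alpha> \<in> simple_roots D" and f: "f \<in> hcarrier" "const (1 + q\<^sup>2) * f \<doteq> 0"
  shows "f \<doteq> 0"
proof -
  define p where "p = (\<Sum>w\<in>{w \<in> weyl D. len D w < len D (reflection D \<alpha> \<circ> w)}. (q\<^sup>2) ^ len D w)"
  \<comment> \<open>The inverse of \<open>1 + q\<^sup>2\<close>: p is its cofactor in
    \<open>poincare_factor\<close>.\<close>
  define c where "c = inverse (poincare D (q\<^sup>2)) * p"
  have c: "c \<in> coeff_ring D"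
    unfolding c_def p_def by blast
  have "c * (1 + q\<^sup>2) = 1"
    using poincare_factor[OF \<alpha>, of "q\<^sup>2"] poincare_nonzero by (simp add: c_def field_simps flip: p_def)
  then have "f = const c * (const (1 + q\<^sup>2) * f)"
    by (simp add: const_mult_const const_simps(2) del: distrib_left_numeral)
  with heq_const[OF c f(2)] show ?thesis
    by simp
qed

text \<open>The relation for \<open>\<mu> - k \<alpha>\<close>: its pairing is d - 2k, so its
  reflection is the weight at place d - k of the same string, and all terms stay within one sequence
  b.\<close>

lemma heq_cross_sequence:
  assumes \<alpha>: "\<alpha> \<in> simple_roots D" and \<mu>: "\<mu> \<in> weight_lattice D" and d: "pairing D \<mu> \<alpha> = real d"
    and e: "e \<in> hcarrier" "e * fT \<alpha> \<doteq> const y * e" "y \<in> coeff_ring D"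
    and f: "f \<in> hcarrier" "fT \<alpha> * f \<doteq> const z * f"
    and k: "2 * k \<le> d"
  defines "b \<equiv> \<lambda>j::nat. e * fX (\<mu> - real j *\<^sub>R \<alpha>) * f"
  shows "const z * b k \<doteq> const y * b (d - k) + const (q - inverse q) * (\<Sum>j<d - 2 * k. b (k + j))"
proof -
  note r = simple_root[OF \<alpha>]
  have shift: "\<mu> - real k *\<^sub>R \<alpha> - real j *\<^sub>R \<alpha> = \<mu> - real (k + j) *\<^sub>R \<alpha>" for j
    by (simp add: algebra_simps)
  have "pairing D (\<mu> - real k *\<^sub>R \<alpha>) \<alpha> = real (d - 2 * k)"
    using k by (simp add: pairing_simps pairing_self[OF r] d of_nat_diff)
  moreover have "\<mu> - real k *\<^sub>R \<alpha> \<in> weight_lattice D"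
    using weight_lattice_sub_root[OF \<mu> r] by simp
  moreover have "k + (d - 2 * k) = d - k"
    using k by simp
  ultimately show ?thesis
    using heq_cross_sandwich[OF \<alpha> _ _ e f, of "\<mu> - real k *\<^sub>R \<alpha>" "d - 2 * k"]
    by (simp only: b_def shift)
qed

text \<open>Normalises the relations: scaling by \<open>inverse q\<close> makes the outer
  coefficients 1 for M, and scaling by q turns \<open>inverse (- q)\<close> into -1 for A.\<close>

lemma heq_const_cancel:
  assumes "c \<in> coeff_ring D" "const z * f \<doteq> const y * g + const x * h" "c * z = z'" "c * y = y'" "c * x = x'"
  shows "const z' * f \<doteq> const y' * g + const x' * h"
  using heq_const[OF assms(1,2)] by (simp add: distrib_left const_mult_const assms(3-5))

section \<open>Lifts of the two idempotents to the free algebra\<close>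

definition one_lift :: "'v hgen word \<Rightarrow>\<^sub>0 ratfun" where
  "one_lift = const (inverse (poincare D (q\<^sup>2))) * T_sum q"

definition eps_lift :: "'v hgen word \<Rightarrow>\<^sub>0 ratfun" where
  "eps_lift = const (inverse (poincare D ((inverse q)\<^sup>2))) * T_sum (inverse (- q))"

lemma inverse_uminus_q: "inverse (- q) \<in> coeff_ring D"
  "inverse (- q) \<noteq> 0" "inverse (- q) - inverse (inverse (- q)) = q - inverse q"
  using coeff_ring_uminus[OF inverse_q_coeff_ring] by simp_all

lemma one_lift_carrier: "one_lift \<in> hcarrier"
  unfolding one_lift_def
  by (intro hcarrier_mult hcarrier_const T_sum_carrier inverse_poincare_coeff_ring q_coeff_ring)

lemma eps_lift_carrier: "eps_lift \<in> hcarrier"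
  unfolding eps_lift_def
  by (intro hcarrier_mult hcarrier_const T_sum_carrier inverse_poincare_inverse_coeff_ring inverse_uminus_q)

lemma one_lift_left: "\<alpha> \<in> simple_roots D \<Longrightarrow> fT \<alpha> * one_lift \<doteq> const q * one_lift"
  using heq_const[OF inverse_poincare_coeff_ring T_sum_left[OF _ q_coeff_ring q_nonzero refl], of \<alpha>]
  by (simp only: one_lift_def const_left_commute[where f = "fT \<alpha>"]
      const_left_commute[where f = "const q" and c = "inverse (poincare D (q\<^sup>2))"])

lemma one_lift_right: "\<alpha> \<in> simple_roots D \<Longrightarrow> one_lift * fT \<alpha> \<doteq> const q * one_lift"
  using heq_const[OF inverse_poincare_coeff_ring T_sum_right[OF _ q_coeff_ring q_nonzero refl], of \<alpha>]
  by (simp only: one_lift_def mult.assoc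
      const_left_commute[where f = "const q" and c = "inverse (poincare D (q\<^sup>2))"])

lemma eps_lift_right: "\<alpha> \<in> simple_roots D \<Longrightarrow> eps_lift * fT \<alpha> \<doteq> const (inverse (- q)) * eps_lift"
  using heq_const[OF inverse_poincare_inverse_coeff_ring T_sum_right[OF _ inverse_uminus_q], of \<alpha>]
  by (simp only: eps_lift_def mult.assoc
      const_left_commute[where f = "const (inverse (- q))" and c = "inverse (poincare D ((inverse q)\<^sup>2))"])

lemma sandwich_carrier:
  assumes "\<alpha> \<in> simple_roots D" "\<mu> \<in> weight_lattice D" "e \<in> hcarrier" "f \<in> hcarrier"
  shows "e * fX (\<mu> - real j *\<^sub>R \<alpha>) * f \<in> hcarrier"
  using weight_lattice_sub_root[OF assms(2) simple_root[OF assms(1)], of "real j"] assms(3,4)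
  by (intro hcarrier_mult hcarrier_fX) auto

lemma one_lift_straightening:
  assumes \<alpha>: "\<alpha> \<in> simple_roots D" and \<mu>: "\<mu> \<in> weight_lattice D" and d: "pairing D \<mu> \<alpha> = real d"
    and "0 < d"
  defines "b \<equiv> \<lambda>j::nat. one_lift * fX (\<mu> - real j *\<^sub>R \<alpha>) * one_lift"
  shows "b d \<doteq> straightening ((inverse q)\<^sup>2) d b"
proof (rule heq_straightening)
  show "(inverse q)\<^sup>2 \<in> coeff_ring D"
    by blast
  show "b j \<in> hcarrier" for j
    unfolding b_def by (rule sandwich_carrier[OF \<alpha> \<mu> one_lift_carrier one_lift_carrier])
  fix k
  assume k: "2 * k \<le> d"
  have "const q * b k \<doteq> const q * b (d - k) + const (q - inverse q) * (\<Sum>j<d - 2 * k. b (k + j))"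
    unfolding b_def
    by (rule heq_cross_sequence[OF \<alpha> \<mu> d one_lift_carrier one_lift_right[OF \<alpha>] q_coeff_ring
          one_lift_carrier one_lift_left[OF \<alpha>] k])
  from heq_const_cancel[OF inverse_q_coeff_ring this, of 1 1 "1 - (inverse q)\<^sup>2"]
  show "b k \<doteq> b (d - k) + const (1 - (inverse q)\<^sup>2) * (\<Sum>j<d - 2 * k. b (k + j))"
    by (simp add: const_simps(2) power2_eq_square right_diff_distrib)
qed fact

lemma eps_lift_antisymmetric:
  assumes \<alpha>: "\<alpha> \<in> simple_roots D" and \<mu>: "\<mu> \<in> weight_lattice D" and d: "pairing D \<mu> \<alpha> = real d"
  defines "b \<equiv> \<lambda>j::nat. eps_lift * fX (\<mu> - real j *\<^sub>R \<alpha>) * one_lift"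
  shows "b d \<doteq> - b 0"
proof (rule heq_antisymmetric)
  show "f \<doteq> 0" if "f \<in> hcarrier" "const (1 + q\<^sup>2) * f \<doteq> 0" for f
    using heq_torsion_free[OF \<alpha> that] .
  show "b j \<in> hcarrier" for j
    unfolding b_def by (rule sandwich_carrier[OF \<alpha> \<mu> eps_lift_carrier one_lift_carrier])
  fix k
  assume k: "2 * k \<le> d"
  have "const q * b k \<doteq> const (inverse (- q)) * b (d - k) + const (q - inverse q) * (\<Sum>j<d - 2 * k. b (k + j))"
    unfolding b_def
    by (rule heq_cross_sequence[OF \<alpha> \<mu> d eps_lift_carrier eps_lift_right[OF \<alpha>] inverse_uminus_q(1)
          one_lift_carrier one_lift_left[OF \<alpha>] k])
  from heq_const_cancel[OF q_coeff_ring this, of "q\<^sup>2" "- 1" "q\<^sup>2 - 1"]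
  show "const (q\<^sup>2) * b k \<doteq> - b (d - k) + const (q\<^sup>2 - 1) * (\<Sum>j<d - 2 * k. b (k + j))"
    by (simp add: const_simps(2,5) power2_eq_square right_diff_distrib)
qed

subsection \<open>Passage to the quotient\<close>

lemma hecke_simps:
  "carrier (hecke D) = carrier (hecke_free D Quot hecke_ideal D)"
  "x \<otimes>\<^bsub>hecke D\<^esub> y = x \<otimes>\<^bsub>hecke_free D Quot hecke_ideal D\<^esub> y"
  "x \<oplus>\<^bsub>hecke D\<^esub> y = x \<oplus>\<^bsub>hecke_free D Quot hecke_ideal D\<^esub> y"
  "\<one>\<^bsub>hecke D\<^esub> = \<one>\<^bsub>hecke_free D Quot hecke_ideal D\<^esub>"
  "\<zero>\<^bsub>hecke D\<^esub> = \<zero>\<^bsub>hecke_free D Quot hecke_ideal D\<^esub>"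
  "c \<odot>\<^bsub>hecke D\<^esub> x = hclass D (const c) \<otimes>\<^bsub>hecke_free D Quot hecke_ideal D\<^esub> x"
  by (simp_all add: hecke_def Let_def ring.defs module.defs)

text \<open>\<open>hecke D\<close> is a module record extending the quotient ring, a different type,
  so the group axioms are carried over one by one; finite sums in \<open>hecke D\<close> rely on
  them.\<close>

lemma abelian_group_hecke: "abelian_group (hecke D)"
proof -
  interpret Q: ring "hecke_free D Quot hecke_ideal D"
    by (rule ideal.quotient_is_ring[OF ideal_hecke])
  show ?thesis
    by (rule abelian_groupI; unfold hecke_simps;
        rule abelian_groupE[OF Q.abelian_group_axioms]; assumption)
qed

lemma hclass_hom: "hclass D \<in> ring_hom (hecke_free D) (hecke_free D Quot hecke_ideal D)"
  using ideal.rcos_ring_hom[OF ideal_hecke] by (simp add: hclass_def[abs_def])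

lemma hclass_carrier: "f \<in> hcarrier \<Longrightarrow> hclass D f \<in> carrier (hecke D)"
  using ring_hom_closed[OF hclass_hom] by (simp add: hecke_simps)

lemma hclass_mult: "f \<in> hcarrier \<Longrightarrow> g \<in> hcarrier \<Longrightarrow> hclass D f \<otimes>\<^bsub>hecke D\<^esub> hclass D g = hclass D (f * g)"
  using ring_hom_mult[OF hclass_hom, of f g] by (simp add: hecke_simps)

lemma hclass_add: "f \<in> hcarrier \<Longrightarrow> g \<in> hcarrier \<Longrightarrow> hclass D f \<oplus>\<^bsub>hecke D\<^esub> hclass D g = hclass D (f + g)"
  using ring_hom_add[OF hclass_hom, of f g] by (simp add: hecke_simps)

lemma hclass_one: "hclass D 1 = \<one>\<^bsub>hecke D\<^esub>"
  using ring_hom_one[OF hclass_hom] by (simp add: hecke_simps)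

lemma hclass_smult: "c \<in> coeff_ring D \<Longrightarrow> f \<in> hcarrier \<Longrightarrow> c \<odot>\<^bsub>hecke D\<^esub> hclass D f = hclass D (const c * f)"
  using hclass_mult[of "const c" f] by (simp add: hecke_simps hcarrier_const)

lemma hclass_eq:
  assumes "f \<doteq> g"
  shows "hclass D f = hclass D g"
proof -
  interpret R: ring "hecke_free D" by (rule ring_hecke_free)
  interpret I: ideal "hecke_ideal D" "hecke_free D" by (rule ideal_hecke)
  have "(f - g) \<oplus>\<^bsub>hecke_free D\<^esub> g \<in> hecke_ideal D +>\<^bsub>hecke_free D\<^esub> g"
    using assms by (intro R.a_rcosI) (auto simp: heq_def hecke_ideal_carrier)
  then have "f \<in> hecke_ideal D +>\<^bsub>hecke_free D\<^esub> g"
    by simp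
  then show ?thesis
    using R.a_repr_independence[OF _ heq_carrier(2)[OF assms] I.a_subgroup]
    by (simp add: hclass_def)
qed

lemma hclass_zero: "hclass D 0 = \<zero>\<^bsub>hecke D\<^esub>"
proof -
  interpret G: abelian_group "hecke D" by (rule abelian_group_hecke)
  have "hclass D 0 \<oplus>\<^bsub>hecke D\<^esub> hclass D 0 = hclass D 0"
    by (simp add: hclass_add hcarrier_zero)
  then show ?thesis
    using hclass_carrier[OF hcarrier_zero] G.add.l_cancel_one by metis
qed

lemma hclass_uminus:
  assumes "f \<in> hcarrier"
  shows "hclass D (- f) = \<ominus>\<^bsub>hecke D\<^esub> hclass D f"
proof -
  interpret G: abelian_group "hecke D" by (rule abelian_group_hecke)
  have "hclass D (- f) \<oplus>\<^bsub>hecke D\<^esub> hclass D f = \<zero>\<^bsub>hecke D\<^esub>"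
    using assms by (simp add: hclass_add hcarrier_uminus hclass_zero)
  then show ?thesis
    using G.minus_equality hclass_carrier assms hcarrier_uminus by metis
qed

lemma hclass_sum:
  assumes "finite A" "\<And>i. i \<in> A \<Longrightarrow> f i \<in> hcarrier" "\<And>i. i \<in> A \<Longrightarrow> h i = hclass D (f i)"
  shows "(\<Oplus>\<^bsub>hecke D\<^esub>i\<in>A. h i) = hclass D (sum f A)"
  using assms
proof (induction A rule: finite_induct)
  case empty
  interpret G: abelian_group "hecke D" by (rule abelian_group_hecke)
  show ?case by (simp add: hclass_zero)
next
  case (insert i A)
  interpret G: abelian_group "hecke D" by (rule abelian_group_hecke)
  have "h \<in> A \<rightarrow> carrier (hecke D)" "h i \<in> carrier (hecke D)"
    using insert.prems by (auto simp: hclass_carrier)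
  then show ?case
    using insert by (simp add: G.finsum_insert hclass_add hcarrier_sum)
qed

lemma hTw_eq:
  assumes "w \<in> weyl D"
  shows "hTw D w = hclass D (T_elt w)"
proof -
  have "foldr (\<lambda>\<alpha> h. hT D \<alpha> \<otimes>\<^bsub>hecke D\<^esub> h) u \<one>\<^bsub>hecke D\<^esub> = hclass D (prod_list (map fT u))"
    if "set u \<subseteq> simple_roots D" for u
    using that
    by (induction u) (simp_all add: hclass_one hT_def hclass_mult hcarrier_fT hcarrier_T_word)
  moreover have "set (SOME u. reduced_word D w u) \<subseteq> simple_roots D"
    using reduced_wordD(1)[OF someI_ex[OF ex_reduced_word[OF assms]]] .
  ultimately show ?thesis
    by (simp add: hTw_def T_elt_def)
qed

lemma hclass_T_sum:
  assumes "c \<in> coeff_ring D"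
  shows "(\<Oplus>\<^bsub>hecke D\<^esub>w\<in>weyl D. c ^ len D w \<odot>\<^bsub>hecke D\<^esub> hTw D w) = hclass D (T_sum c)"
  unfolding T_sum_def
proof (rule hclass_sum[OF finite_weyl])
  fix w
  assume w: "w \<in> weyl D"
  show "const (c ^ len D w) * T_elt w \<in> hcarrier"
    using assms w by (intro hcarrier_mult hcarrier_const coeff_ring_power T_elt_carrier)
  show "c ^ len D w \<odot>\<^bsub>hecke D\<^esub> hTw D w = hclass D (const (c ^ len D w) * T_elt w)"
    using assms w by (simp add: hTw_eq hclass_smult coeff_ring_power T_elt_carrier)
qed

lemma one0_eq: "one0 D = hclass D one_lift"
  by (simp add: one0_def one_lift_def hclass_T_sum hclass_smult T_sum_carrier q_coeff_ring
      inverse_poincare_coeff_ring)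

lemma eps0_eq: "eps0 D = hclass D eps_lift"
  unfolding eps0_def eps_lift_def
  by (simp only: hclass_T_sum hclass_smult T_sum_carrier inverse_uminus_q(1)
      inverse_poincare_inverse_coeff_ring)

lemma M_elt_eq: "\<nu> \<in> weight_lattice D \<Longrightarrow> M_elt D \<nu> = hclass D (one_lift * fX \<nu> * one_lift)"
  by (simp add: M_elt_def one0_eq hX_def hclass_mult one_lift_carrier hcarrier_fX hcarrier_mult)

lemma A_elt_eq: "\<nu> \<in> weight_lattice D \<Longrightarrow> A_elt D \<nu> = hclass D (eps_lift * fX \<nu> * one_lift)"
  by (simp add: A_elt_def one0_eq eps0_eq hX_def hclass_mult one_lift_carrier eps_lift_carrier
      hcarrier_fX hcarrier_mult)

section \<open>The reflection identities in the Hecke algebra\<close>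

lemma orbit_sum_reflection:
  assumes "\<alpha> \<in> roots D"
  shows "orbit_sum D (reflection D \<alpha> \<mu>) = orbit_sum D \<mu>"
proof -
  have "(\<lambda>w. w (reflection D \<alpha> \<mu>)) ` weyl D = (\<lambda>w. w \<mu>) ` (\<lambda>w. w \<circ> reflection D \<alpha>) ` weyl D"
    by (simp add: image_image)
  also have "(\<lambda>w. w \<circ> reflection D \<alpha>) ` weyl D = weyl D"
    using bij_betw_reflection_right[OF assms] by (rule bij_betw_imp_surj_on)
  finally show ?thesis
    by (simp add: orbit_sum_def)
qed

lemma alt_sum_eq:
  assumes "\<mu> \<in> weight_lattice D"
  shows "alt_sum D \<mu> = hclass D (\<Sum>w\<in>weyl D. const ((- 1) ^ len D w) * fX (w \<mu>))"
  unfolding alt_sum_def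
proof (rule hclass_sum[OF finite_weyl])
  fix w
  assume w: "w \<in> weyl D"
  have X: "fX (w \<mu>) \<in> hcarrier"
    by (rule hcarrier_fX[OF weight_lattice_weyl[OF w assms]])
  have c: "(- 1) ^ len D w \<in> coeff_ring D"
    by blast
  show "const ((- 1) ^ len D w) * fX (w \<mu>) \<in> hcarrier"
    by (intro hcarrier_mult hcarrier_const c X)
  show "(- 1) ^ len D w \<odot>\<^bsub>hecke D\<^esub> hX D (w \<mu>) = hclass D (const ((- 1) ^ len D w) * fX (w \<mu>))"
    unfolding hX_def by (rule hclass_smult[OF c X])
qed

text \<open>Reindexing by right multiplication with the simple reflection changes each length by
  one, hence flips every sign.\<close>

lemma alt_sum_reflection:
  assumes \<alpha>: "\<alpha> \<in> simple_roots D" and \<mu>: "\<mu> \<in> weight_lattice D"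
  shows "alt_sum D (reflection D \<alpha> \<mu>) = \<ominus>\<^bsub>hecke D\<^esub> alt_sum D \<mu>"
proof -
  note r = simple_root[OF \<alpha>]
  let ?a = "\<lambda>\<nu>. \<Sum>w\<in>weyl D. const ((- 1) ^ len D w) * fX (w \<nu>)"
  have carrier: "?a \<mu> \<in> hcarrier"
    by (intro hcarrier_sum hcarrier_mult hcarrier_const hcarrier_fX[OF weight_lattice_weyl[OF _ \<mu>]])
      auto
  have "?a \<mu> = (\<Sum>w\<in>weyl D. const ((- 1) ^ len D (w \<circ> reflection D \<alpha>)) * fX ((w \<circ> reflection D \<alpha>) \<mu>))"
    by (rule sum.reindex_bij_betw[OF bij_betw_reflection_right[OF r], symmetric])
  also have "\<dots> = (\<Sum>w\<in>weyl D. - (const ((- 1) ^ len D w) * fX (w (reflection D \<alpha> \<mu>))))"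
  proof (rule sum.cong[OF refl])
    fix w
    assume "w \<in> weyl D"
    then have "(- 1 :: ratfun) ^ len D (w \<circ> reflection D \<alpha>) = - ((- 1) ^ len D w)"
      using len_reflection_right[of w \<alpha>] \<alpha> by auto
    then show "const ((- 1) ^ len D (w \<circ> reflection D \<alpha>)) * fX ((w \<circ> reflection D \<alpha>) \<mu>) =
        - (const ((- 1) ^ len D w) * fX (w (reflection D \<alpha> \<mu>)))"
      by (simp add: const_simps)
  qed
  also have "\<dots> = - ?a (reflection D \<alpha> \<mu>)"
    by (rule sum_negf)
  finally have "?a (reflection D \<alpha> \<mu>) = - ?a \<mu>"
    by simp
  then show ?thesis
    using hclass_uminus[OF carrier] weight_lattice_reflection[OF \<mu> r] by (simp add: alt_sum_eq \<mu>)
qed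

lemma A_elt_reflection:
  assumes \<alpha>: "\<alpha> \<in> simple_roots D" and \<mu>: "\<mu> \<in> weight_lattice D" and d: "pairing D \<mu> \<alpha> = real d"
  shows "A_elt D (reflection D \<alpha> \<mu>) = \<ominus>\<^bsub>hecke D\<^esub> A_elt D \<mu>"
  using hclass_eq[OF eps_lift_antisymmetric[OF assms]] weight_lattice_reflection[OF \<mu> simple_root[OF \<alpha>]]
  by (simp add: A_elt_eq \<mu> hclass_uminus hcarrier_mult eps_lift_carrier one_lift_carrier hcarrier_fX)
    (simp add: reflection_def d)

lemma M_elt_reflection:
  assumes \<alpha>: "\<alpha> \<in> simple_roots D" and \<mu>: "\<mu> \<in> weight_lattice D" and d: "pairing D \<mu> \<alpha> = real d"
    and pos: "0 < d"
  defines "t \<equiv> (inverse q)\<^sup>2"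
  shows "M_elt D (reflection D \<alpha> \<mu>) =
    t \<odot>\<^bsub>hecke D\<^esub> M_elt D \<mu>
    \<oplus>\<^bsub>hecke D\<^esub> (\<Oplus>\<^bsub>hecke D\<^esub>j\<in>{1..(d - 1) div 2}.
      ((t ^ 2 - 1) * t ^ (j - 1)) \<odot>\<^bsub>hecke D\<^esub> M_elt D (\<mu> - real j *\<^sub>R \<alpha>))
    \<oplus>\<^bsub>hecke D\<^esub> (if even d
      then ((t - 1) * t ^ (d div 2 - 1)) \<odot>\<^bsub>hecke D\<^esub> M_elt D (\<mu> - real (d div 2) *\<^sub>R \<alpha>)
      else \<zero>\<^bsub>hecke D\<^esub>)"
proof -
  define b where "b j = one_lift * fX (\<mu> - real j *\<^sub>R \<alpha>) * one_lift" for j :: nat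
  have b: "b j \<in> hcarrier" for j
    unfolding b_def by (rule sandwich_carrier[OF \<alpha> \<mu> one_lift_carrier one_lift_carrier])
  have M: "M_elt D (\<mu> - real j *\<^sub>R \<alpha>) = hclass D (b j)" for j
    unfolding b_def using weight_lattice_sub_root[OF \<mu> simple_root[OF \<alpha>], of "real j"]
    by (intro M_elt_eq) simp
  have t: "t \<in> coeff_ring D" and c: "(t ^ 2 - 1) * t ^ k \<in> coeff_ring D" "(t - 1) * t ^ k \<in> coeff_ring D" for k
    unfolding t_def by blast+
  have 1: "t \<odot>\<^bsub>hecke D\<^esub> M_elt D \<mu> = hclass D (const t * b 0)"
    using M[of 0] t b by (simp add: hclass_smult)
  have 2: "(\<Oplus>\<^bsub>hecke D\<^esub>j\<in>{1..(d - 1) div 2}.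
      ((t ^ 2 - 1) * t ^ (j - 1)) \<odot>\<^bsub>hecke D\<^esub> M_elt D (\<mu> - real j *\<^sub>R \<alpha>)) =
    hclass D (\<Sum>j\<in>{1..(d - 1) div 2}. const ((t ^ 2 - 1) * t ^ (j - 1)) * b j)"
    by (rule hclass_sum) (simp_all only: finite_atLeastAtMost M hclass_smult c b hcarrier_mult hcarrier_const)
  have 3: "(if even d
      then ((t - 1) * t ^ (d div 2 - 1)) \<odot>\<^bsub>hecke D\<^esub> M_elt D (\<mu> - real (d div 2) *\<^sub>R \<alpha>)
      else \<zero>\<^bsub>hecke D\<^esub>) =
    hclass D (if even d then const ((t - 1) * t ^ (d div 2 - 1)) * b (d div 2) else 0)"
    by (cases "even d") (simp_all only: M hclass_smult c b hclass_zero if_True if_False)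
  have carrier: "const t * b 0 \<in> hcarrier"
    "(\<Sum>j\<in>{1..(d - 1) div 2}. const ((t ^ 2 - 1) * t ^ (j - 1)) * b j) \<in> hcarrier"
    "(if even d then const ((t - 1) * t ^ (d div 2 - 1)) * b (d div 2) else 0) \<in> hcarrier"
    by (auto intro!: hcarrier_sum hcarrier_mult hcarrier_const b t c hcarrier_zero simp del: One_nat_def)
  have "M_elt D (reflection D \<alpha> \<mu>) = hclass D (b d)"
    using M[of d] by (simp add: reflection_def d)
  also have "\<dots> = hclass D (straightening t d b)"
    using one_lift_straightening[OF \<alpha> \<mu> d pos] unfolding t_def b_def[abs_def] by (rule hclass_eq)
  finally show ?thesis
    by (simp only: 1 2 3 straightening_def hclass_add carrier hcarrier_add)
qed

end

theorem proposition2p5: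
  fixes D :: "('v::real_vector) root_data" and \<alpha> \<mu> :: 'v and d :: nat
  assumes "root_system D"
    and "\<alpha> \<in> simple_roots D"
    and "\<mu> \<in> weight_lattice D"
    and "pairing D \<mu> \<alpha> = real d"
  shows
    "let H = hecke D; t = inverse q ^ 2; s = reflection D \<alpha>; M = M_elt D in
       orbit_sum D (s \<mu>) = orbit_sum D \<mu> \<and>
       alt_sum D (s \<mu>) = \<ominus>\<^bsub>H\<^esub> alt_sum D \<mu> \<and>
       A_elt D (s \<mu>) = \<ominus>\<^bsub>H\<^esub> A_elt D \<mu> \<and>
       (d = 0 \<longrightarrow> M (s \<mu>) = M \<mu>) \<and>
       (d > 0 \<longrightarrow>
         M (s \<mu>) =
           t \<odot>\<^bsub>H\<^esub> M \<mu>
           \<oplus>\<^bsub>H\<^esub> (\<Oplus>\<^bsub>H\<^esub>j\<in>{1..(d - 1) div 2}.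
                 ((t ^ 2 - 1) * t ^ (j - 1)) \<odot>\<^bsub>H\<^esub> M (\<mu> - real j *\<^sub>R \<alpha>))
           \<oplus>\<^bsub>H\<^esub> (if even d
                 then ((t - 1) * t ^ (d div 2 - 1)) \<odot>\<^bsub>H\<^esub> M (\<mu> - real (d div 2) *\<^sub>R \<alpha>)
                 else \<zero>\<^bsub>H\<^esub>))"
proof -
  interpret root_system D by fact
  \<comment> \<open>For d = 0 the reflection fixes \<mu>, so the two elements are literally the
    same.\<close>
  have "d = 0 \<longrightarrow> M_elt D (reflection D \<alpha> \<mu>) = M_elt D \<mu>"
    by (simp add: reflection_def assms(4))
  then show ?thesis
    unfolding Let_def
    using orbit_sum_reflection[OF simple_root[OF assms(2)]] alt_sum_reflection[OF assms(2,3)]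
      A_elt_reflection[OF assms(2-4)] M_elt_reflection[OF assms(2-4)]
    by (intro conjI impI) simp_all
qed

end
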